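(* Let $\mathcal P$ and $\mathcal Q$ be directly regular polyhedra (that is, directly regular $3$-polytopes). Then $\mathcal P\diamond\mathcal Q$ is a directly regular polyhedron.
   Context: Polytopes. An (abstract) $n$-polytope is a ranked poset with ranks $-1,\dots,n$ such that: there are a unique least face (rank $-1$) and a unique greatest face (rank $n$); every flag (maximal chain) has $n+2$ faces; it is strongly flag-connected (any two flags $\Phi,\Psi$ are joined by a sequence of flags, consecutive ones differing in exactly one face, all containing $\Phi\cap\Psi$); and whenever $F<G$ have ranks $j-1$ and $j+1$ there are exactly two $j$-faces strictly between them. A polyhedron is a $3$-polytope. Regularity. $\mathcal P$ is regular if its automorphism group $\Gamma(\mathcal P)$ is transitive on flags. Fixing a base flag $\Phi$, $\Gamma(\mathcal P)=\langle\rho_0,\dots,\rho_{n-1}\rangle$, where $\rho_i$ maps $\Phi$ to the flag differing from it exactly in the $i$-face. Put $\sigma_i=\rho_{i-1}\rho_i$ for $1\le i\le n-1$; the rotation subgroup is $\Gamma^+(\mathcal P)=\langle\sigma_1,\dots,\sigma_{n-1}\rangle$, and $\mathcal P$ is directly regular if it has index $2$ in $\Gamma(\mathcal P)$. Mix. For directly regular $n$-polytopes with $\Gamma^+(\mathcal P)=\langle\sigma_1,\dots,\sigma_{n-1}\rangle$ and $\Gamma^+(\mathcal Q)=\langle\sigma_1',\dots,\sigma_{n-1}'\rangle$, let $\beta_i=(\sigma_i,\sigma_i')$ and $\Gamma^+=\Gamma^+(\mathcal P)\diamond\Gamma^+(\mathcal Q)=\langle\beta_1,\dots,\beta_{n-1}\rangle\le\Gamma^+(\mathcal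 P)\times\Gamma^+(\mathcal Q)$. For $I\subseteq\{0,\dots,n-1\}$ put $\Gamma^+_I=\langle\beta_i\beta_{i+1}\cdots\beta_j\mid 1\le i\le j\le n-1,\ i-1\in I,\ j\in I\rangle$. For $n\ge 3$ the mix $\mathcal P\diamond\mathcal Q$ is the poset whose $j$-faces ($0\le j\le n-1$) are the right cosets of $\Gamma^+_{\{0,\dots,n-1\}\setminus\{j\}}$ in $\Gamma^+$, together with a least face of rank $-1$ and a greatest face of rank $n$, where a $j$-face is below a $k$-face ($j<k$) if and only if the two cosets intersect. This poset is always a directly regular flag-connected pre-polytope (it satisfies all axioms of a polytope except possibly strong flag-connectivity); it is a polytope if and only if $\Gamma^+_I\cap\Gamma^+_J=\Gamma^+_{I\cap J}$ for all $I,J\subseteq\{0,\dots,n-1\}$ (the intersection property). *)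

theory Defs
  imports
    "HOL-Algebra.Order"
    "HOL-Algebra.Bij"
    "HOL-Algebra.Generated_Groups"
begin

section \<open>Abstract polytopes\<close>

record 'a ranked_poset = "'a gorder" +
  face_rank :: "'a \<Rightarrow> int"

definition flag :: "('a, 'm) gorder_scheme \<Rightarrow> 'a set \<Rightarrow> bool"
  where "flag P \<Phi> \<longleftrightarrow> pred_on.maxchain (carrier P) (le P) \<Phi>"

definition adjacent :: "'a set \<Rightarrow> 'a set \<Rightarrow> bool"
  where "adjacent \<Phi> \<Psi> \<longleftrightarrow> card (\<Phi> - \<Psi>) = 1 \<and> card (\<Psi> - \<Phi>) = 1"

definition strongly_flag_connected :: "('a, 'm) gorder_scheme \<Rightarrow> bool"
  where "strongly_flag_connected P \<longleftrightarrow>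
    (\<forall>\<Phi> \<Psi>. flag P \<Phi> \<longrightarrow> flag P \<Psi> \<longrightarrow>
      (\<lambda>X Y. flag P X \<and> flag P Y \<and> adjacent X Y
             \<and> \<Phi> \<inter> \<Psi> \<subseteq> X \<and> \<Phi> \<inter> \<Psi> \<subseteq> Y)\<^sup>*\<^sup>* \<Phi> \<Psi>)"

locale polytope = partial_order P
  for n :: nat and P :: "('a, 'm) ranked_poset_scheme" (structure) +
  assumes rank_range: "F \<in> carrier P \<Longrightarrow> face_rank P F \<in> {-1..int n}"
    and rank_less: "\<lbrakk>F \<in> carrier P; G \<in> carrier P; F \<sqsubset> G\<rbrakk> \<Longrightarrow> face_rank P F < face_rank P G"
    and least_face: "\<exists>!F. least P F (carrier P) \<and> face_rank P F = -1"
    and greatest_face: "\<exists>!F. greatest P F (carrier P) \<and> face_rank P F = int n"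
    and flag_card: "flag P \<Phi> \<Longrightarrow> card \<Phi> = n + 2"
    and strong_flag_connectivity: "strongly_flag_connected P"
    and diamond: "\<lbrakk>F \<in> carrier P; G \<in> carrier P; F \<sqsubset> G;
        face_rank P F = j - 1; face_rank P G = j + 1\<rbrakk>
      \<Longrightarrow> card {H \<in> carrier P. face_rank P H = j \<and> F \<sqsubset> H \<and> H \<sqsubset> G} = 2"


section \<open>Automorphisms and direct regularity\<close>

text \<open>
  Automorphisms are extensional functions on the set of faces, and the product of two of them is
  composition of functions, as in \<^const>\<open>BijGroup\<close>. Order automorphisms of a polytope
  preserve the rank.
\<close>

definition aut_group :: "('a, 'm) gorder_scheme \<Rightarrow> ('a \<Rightarrow> 'a) monoid"
  where "aut_group P =
    (BijGroup (carrier P)) \<lparr>carrier := {f \<in> Bij (carrier P). order_emb P P f}\<rparr>"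

definition regular :: "('a, 'm) gorder_scheme \<Rightarrow> bool"
  where "regular P \<longleftrightarrow>
    (\<forall>\<Phi> \<Psi>. flag P \<Phi> \<longrightarrow> flag P \<Psi> \<longrightarrow> (\<exists>\<gamma> \<in> carrier (aut_group P). \<gamma> ` \<Phi> = \<Psi>))"

definition differ_exactly_at ::
    "('a, 'm) ranked_poset_scheme \<Rightarrow> nat \<Rightarrow> 'a set \<Rightarrow> 'a set \<Rightarrow> bool"
  where "differ_exactly_at P i \<Phi> \<Psi> \<longleftrightarrow>
    \<Phi> \<noteq> \<Psi> \<and> {F \<in> \<Phi>. face_rank P F \<noteq> int i} = {F \<in> \<Psi>. face_rank P F \<noteq> int i}"

definition \<rho> :: "('a, 'm) ranked_poset_scheme \<Rightarrow> 'a set \<Rightarrow> nat \<Rightarrow> 'a \<Rightarrow> 'a"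
  where "\<rho> P \<Phi> i =
    (THE \<gamma>. \<gamma> \<in> carrier (aut_group P) \<and> flag P (\<gamma> ` \<Phi>) \<and> differ_exactly_at P i \<Phi> (\<gamma> ` \<Phi>))"

definition \<sigma> :: "('a, 'm) ranked_poset_scheme \<Rightarrow> 'a set \<Rightarrow> nat \<Rightarrow> 'a \<Rightarrow> 'a"
  where "\<sigma> P \<Phi> i = \<rho> P \<Phi> (i - 1) \<otimes>\<^bsub>aut_group P\<^esub> \<rho> P \<Phi> i"

definition rotation_group ::
    "nat \<Rightarrow> ('a, 'm) ranked_poset_scheme \<Rightarrow> 'a set \<Rightarrow> ('a \<Rightarrow> 'a) monoid"
  where "rotation_group n P \<Phi> = subgroup_generated (aut_group P) (\<sigma> P \<Phi> ` {1..n - 1})"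

text \<open>
  For a regular polytope the rotation subgroups of different base flags are conjugate, so the
  quantifier over base flags below could equally be existential.
\<close>

definition directly_regular_polytope :: "nat \<Rightarrow> ('a, 'm) ranked_poset_scheme \<Rightarrow> bool"
  where "directly_regular_polytope n P \<longleftrightarrow>
    polytope n P \<and> regular P \<and>
    (\<forall>\<Phi>. flag P \<Phi> \<longrightarrow>
      card (rcosets\<^bsub>aut_group P\<^esub> (carrier (rotation_group n P \<Phi>))) = 2)"


section \<open>The mix\<close>

definition \<beta> ::
    "('a, 'm) ranked_poset_scheme \<Rightarrow> 'a set \<Rightarrow> ('b, 'k) ranked_poset_scheme \<Rightarrow> 'b set
      \<Rightarrow> nat \<Rightarrow> ('a \<Rightarrow> 'a) \<times> ('b \<Rightarrow> 'b)"
  where "\<beta> P \<Phi> Q \<Psi> i = (\<sigma> P \<Phi> i, \<sigma> Q \<Psi> i)"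

definition mix_group ::
    "nat \<Rightarrow> ('a, 'm) ranked_poset_scheme \<Rightarrow> 'a set \<Rightarrow> ('b, 'k) ranked_poset_scheme \<Rightarrow> 'b set
      \<Rightarrow> (('a \<Rightarrow> 'a) \<times> ('b \<Rightarrow> 'b)) monoid"
  where "mix_group n P \<Phi> Q \<Psi> =
    subgroup_generated (rotation_group n P \<Phi> \<times>\<times> rotation_group n Q \<Psi>) (\<beta> P \<Phi> Q \<Psi> ` {1..n - 1})"

text \<open>The \<^const>\<open>foldr\<close> term is the product \<open>\<beta>\<^sub>i \<beta>\<^sub>i\<^sub>+\<^sub>1 \<dots> \<beta>\<^sub>j\<close>.\<close>

definition mix_subgroup ::
    "nat \<Rightarrow> ('a, 'm) ranked_poset_scheme \<Rightarrow> 'a set \<Rightarrow> ('b, 'k) ranked_poset_scheme \<Rightarrow> 'b set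
      \<Rightarrow> nat set \<Rightarrow> (('a \<Rightarrow> 'a) \<times> ('b \<Rightarrow> 'b)) set"
  where "mix_subgroup n P \<Phi> Q \<Psi> I =
    (let G = mix_group n P \<Phi> Q \<Psi> in
     generate G {foldr (\<lambda>k g. \<beta> P \<Phi> Q \<Psi> k \<otimes>\<^bsub>G\<^esub> g) [i..<Suc j] \<one>\<^bsub>G\<^esub> | i j.
       1 \<le> i \<and> i \<le> j \<and> j \<le> n - 1 \<and> i - 1 \<in> I \<and> j \<in> I})"

text \<open>
  A coset carries its rank, since cosets belonging to different ranks may coincide as sets.
\<close>

datatype 'g mix_face = Least_Face | Coset_Face nat "'g set" | Greatest_Face

primrec mix_face_rank :: "nat \<Rightarrow> 'g mix_face \<Rightarrow> int"
  where
    "mix_face_rank n Least_Face = -1"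
  | "mix_face_rank n (Coset_Face j A) = int j"
  | "mix_face_rank n Greatest_Face = int n"

definition mix_face_le :: "'g mix_face \<Rightarrow> 'g mix_face \<Rightarrow> bool"
  where "mix_face_le F G \<longleftrightarrow>
    F = G \<or> F = Least_Face \<or> G = Greatest_Face \<or>
    (\<exists>j k A B. F = Coset_Face j A \<and> G = Coset_Face k B \<and> j < k \<and> A \<inter> B \<noteq> {})"

definition mix ::
    "nat \<Rightarrow> ('a, 'm) ranked_poset_scheme \<Rightarrow> 'a set \<Rightarrow> ('b, 'k) ranked_poset_scheme \<Rightarrow> 'b set
      \<Rightarrow> (('a \<Rightarrow> 'a) \<times> ('b \<Rightarrow> 'b)) mix_face ranked_poset"
  where "mix n P \<Phi> Q \<Psi> =
    \<lparr>carrier = {Least_Face, Greatest_Face} \<union>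
       {Coset_Face j A | j A. j < n \<and>
          A \<in> rcosets\<^bsub>mix_group n P \<Phi> Q \<Psi>\<^esub> (mix_subgroup n P \<Phi> Q \<Psi> ({0..<n} - {j}))},
     eq = (=),
     le = mix_face_le,
     face_rank = mix_face_rank n\<rparr>"

end

theory Submission
  imports Defs
begin

text \<open>
  The idea is to replace the rotation groups by the full groups. Put
  \<open>r\<^sub>i = (\<rho>\<^sub>i, \<rho>\<^sub>i')\<close> in the direct product of the two automorphism groups and let \<open>G\<close> be the group
  generated by \<open>r\<^sub>0, r\<^sub>1, r\<^sub>2\<close>. Direct regularity of the two polyhedra says that the number of letters
  of a word in the \<open>\<rho>\<^sub>i\<close> has a well-defined parity (\<open>rotation_index_2_iff\<close>, \<open>rotation_parity\<close>), and on
  \<open>G\<close> the two parities agree. The even elements of \<open>G\<close> form the group of the mix, and the even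
  elements of the subgroup generated by the \<open>r\<^sub>i\<close> with \<open>i \<noteq> j\<close> form the subgroup whose cosets are the
  \<open>j\<close>-faces (\<open>mix_group_eq\<close>, \<open>mix_subgroup_eq\<close>).

  The decisive point is the intersection property for the subgroups \<open>G\<^sub>I\<close> generated by the \<open>r\<^sub>i\<close> with
  \<open>i \<in> I\<close>. It is trivial if one of \<open>I\<close>, \<open>J\<close> contains the other. In rank 3 the remaining pairs
  satisfy \<open>I \<inter> J \<subseteq> {k}\<close> for some \<open>k\<close>, so that both components of an element of \<open>G\<^sub>I \<inter> G\<^sub>J\<close> fix all
  faces of their base flags except possibly the \<open>k\<close>-face. Since automorphisms act freely on flags, each
  component is the identity or \<open>\<rho>\<^sub>k\<close>, and the common parity excludes the pairs \<open>(1, \<rho>\<^sub>k')\<close> and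
  \<open>(\<rho>\<^sub>k, 1)\<close>; only \<open>1\<close> and \<open>r\<^sub>k\<close> remain (\<open>intersection_property_small_overlap\<close>).

  Given the intersection property, the elements of \<open>G\<close> correspond to the flags of the coset geometry,
  where \<open>x\<close> and \<open>y\<close> have the same \<open>j\<close>-face if and only if \<open>x y\<^sup>-\<^sup>1\<close> is a word in the \<open>r\<^sub>i\<close> with \<open>i \<noteq> j\<close>,
  and left multiplication by \<open>r\<^sub>i\<close> is the passage to the \<open>i\<close>-adjacent flag. The axioms of a
  polyhedron become statements about the generators (\<open>geometry_polytope\<close>), and right multiplication by elements of \<open>G\<close> is a flag-transitive
  action by automorphisms (\<open>geometry_regular\<close>). Finally, parity in \<open>G\<close> colours the flags in such a way
  that adjacent flags have different colours. Rotations preserve such a colouring and \<open>\<rho>\<^sub>0\<close> does not, so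
  the rotation subgroup has index 2 (\<open>bipartite_imp_rho_not_rotation\<close>).
\<close>

section \<open>Groups generated by involutions\<close>

context group
begin

text \<open>
  A generator that is its own inverse needs no separate inverse letter, so every element is reached by
  appending generators on the right.
\<close>

lemma generate_involutions_induct:
  assumes x: "x \<in> generate G S" and S: "S \<subseteq> carrier G" and inv: "\<And>s. s \<in> S \<Longrightarrow> s \<otimes> s = \<one>"
    and one: "Q \<one>" and step: "\<And>x s. x \<in> generate G S \<Longrightarrow> Q x \<Longrightarrow> s \<in> S \<Longrightarrow> Q (x \<otimes> s)"
  shows "Q x"
proof -
  have "\<forall>y \<in> generate G S. Q y \<longrightarrow> Q (y \<otimes> x)"
    using x
  proof (induction x rule: generate.induct)
    case one
    then show ?case using generate_in_carrier[OF S] by simp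
  next
    case (incl h)
    then show ?case using step by blast
  next
    case (inv h)
    then have "inv h = h"
      using S assms(3) by (meson inv_equality subset_iff)
    then show ?case using inv step by auto
  next
    case (eng h1 h2)
    then show ?case
      using generate.eng generate_in_carrier[OF S] m_assoc by metis
  qed
  then show ?thesis
    using one generate.one[of G S] generate_in_carrier[OF S x] by fastforce
qed

text \<open>
  The subgroup generated by \<open>T\<close> and its coset by \<open>s\<^sub>0\<close> exhaust the group: appending a letter \<open>s\<close> to a
  word moves it from one to the other, because \<open>s s\<^sub>0\<close> and its inverse \<open>s\<^sub>0 s\<close> lie in the subgroup.
\<close>

lemma generate_products_of_involutions:
  assumes S: "S \<subseteq> carrier G" and inv: "\<And>s. s \<in> S \<Longrightarrow> s \<otimes> s = \<one>" and s0: "s\<^sub>0 \<in> S"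
    and T: "T \<subseteq> carrier G" and prod: "\<And>s. s \<in> S \<Longrightarrow> s \<otimes> s\<^sub>0 \<in> generate G T"
    and x: "x \<in> generate G S"
  shows "x \<in> generate G T \<or> x \<otimes> s\<^sub>0 \<in> generate G T"
  using x S inv
proof (rule generate_involutions_induct)
  show "\<one> \<in> generate G T \<or> \<one> \<otimes> s\<^sub>0 \<in> generate G T"
    by (simp add: generate.one)
next
  fix x s
  assume x: "x \<in> generate G S" and IH: "x \<in> generate G T \<or> x \<otimes> s\<^sub>0 \<in> generate G T"
    and s: "s \<in> S"
  have c: "x \<in> carrier G" "s \<in> carrier G" "s\<^sub>0 \<in> carrier G"
    using x s s0 S generate_in_carrier[OF S] by auto
  have "inv (s \<otimes> s\<^sub>0) = s\<^sub>0 \<otimes> s"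
    using c inv[OF s] inv[OF s0] by (simp add: inv_mult_group inv_equality)
  then have s0s: "s\<^sub>0 \<otimes> s \<in> generate G T"
    using generate_m_inv_closed[OF T prod[OF s]] by simp
  from IH show "x \<otimes> s \<in> generate G T \<or> x \<otimes> s \<otimes> s\<^sub>0 \<in> generate G T"
  proof
    assume "x \<in> generate G T"
    then show ?thesis using generate.eng[OF _ prod[OF s]] c by (simp add: m_assoc)
  next
    assume "x \<otimes> s\<^sub>0 \<in> generate G T"
    moreover have "x \<otimes> s\<^sub>0 \<otimes> (s\<^sub>0 \<otimes> s) = x \<otimes> (s\<^sub>0 \<otimes> s\<^sub>0) \<otimes> s"
      using c by (simp add: m_assoc)
    then have "x \<otimes> s\<^sub>0 \<otimes> (s\<^sub>0 \<otimes> s) = x \<otimes> s"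
      using c inv[OF s0] by simp
    ultimately show ?thesis using generate.eng[OF _ s0s] by metis
  qed
qed

text \<open>
  In the presence of a parity the two cosets of the preceding lemma are the even and the odd elements.
  This is how the rotation subgroups, which are given by generators, are recognised inside groups
  generated by reflections.
\<close>

lemma even_elements_eq_generate:
  assumes S: "S \<subseteq> carrier G" and inv: "\<And>s. s \<in> S \<Longrightarrow> s \<otimes> s = \<one>" and s0: "s\<^sub>0 \<in> S"
    and T: "T \<subseteq> generate G S" and prod: "\<And>s. s \<in> S \<Longrightarrow> s \<otimes> s\<^sub>0 \<in> generate G T"
    and mult: "\<And>x y. x \<in> generate G S \<Longrightarrow> y \<in> generate G S \<Longrightarrow> ev (x \<otimes> y) \<longleftrightarrow> (ev x \<longleftrightarrow> ev y)"
    and odd: "\<not> ev s\<^sub>0" and evT: "\<And>t. t \<in> T \<Longrightarrow> ev t"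
  shows "{x \<in> generate G S. ev x} = generate G T"
proof -
  have Tc: "T \<subseteq> carrier G" using T generate_in_carrier[OF S] by auto
  have sub: "generate G T \<subseteq> generate G S"
    using generate_subgroup_incl[OF T generate_is_subgroup[OF S]] .
  have ev1: "ev \<one>" using mult[OF generate.one generate.one] by simp
  have evgen: "ev x" if "x \<in> generate G T" for x
    using that
  proof induction
    case (inv h)
    then have "inv h \<in> generate G S" "h \<in> generate G S" "h \<in> carrier G"
      using T Tc generate_m_inv_closed[OF S] by auto
    then show ?case using mult[of "inv h" h] ev1 evT inv by simp
  qed (use ev1 evT mult sub in auto)
  show ?thesis
  proof (intro equalityI subsetI)
    fix x assume x: "x \<in> {x \<in> generate G S. ev x}"
    show "x \<in> generate G T"
    proof (rule ccontr)
      assume "x \<notin> generate G T"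
      then have "x \<otimes> s\<^sub>0 \<in> generate G T"
        using generate_products_of_involutions[OF S inv s0 Tc prod] x by blast
      then show False using evgen mult[of x s\<^sub>0] x odd s0 generate.incl by fastforce
    qed
  qed (use evgen sub in auto)
qed

end

section \<open>Flags of a polytope\<close>

definition adjacent_flag :: "('a, 'm) ranked_poset_scheme \<Rightarrow> nat \<Rightarrow> 'a set \<Rightarrow> 'a set"
  where "adjacent_flag P i \<Phi> = (THE \<Psi>. flag P \<Psi> \<and> differ_exactly_at P i \<Phi> \<Psi>)"

context polytope
begin

abbreviation rank :: "'a \<Rightarrow> int" where "rank \<equiv> face_rank P"

lemma chain_iff:
  "pred_on.chain (carrier P) (le P) C \<longleftrightarrow>
    C \<subseteq> carrier P \<and> (\<forall>x \<in> C. \<forall>y \<in> C. x \<sqsubseteq> y \<or> y \<sqsubseteq> x)"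
  unfolding pred_on.chain_def using le_refl by blast

lemma chain_rank_inj:
  assumes "pred_on.chain (carrier P) (le P) C" "x \<in> C" "y \<in> C" "rank x = rank y"
  shows "x = y"
  using assms rank_less unfolding chain_iff lless_eq by (metis order_less_irrefl subsetD)

lemma chain_le_iff:
  assumes C: "pred_on.chain (carrier P) (le P) C" and x: "x \<in> C" and y: "y \<in> C"
  shows "x \<sqsubseteq> y \<longleftrightarrow> rank x \<le> rank y"
proof (cases "x = y")
  case True
  then show ?thesis using C x le_refl unfolding chain_iff by blast
next
  case False
  have c: "x \<in> carrier P" "y \<in> carrier P" "x \<sqsubseteq> y \<or> y \<sqsubseteq> x"
    using C x y unfolding chain_iff by auto
  show ?thesis
  proof (cases "x \<sqsubseteq> y")
    case True
    then show ?thesis using rank_less[of x y] c False unfolding lless_eq by simp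
  next
    case nle: False
    then have "rank y < rank x" using rank_less[of y x] c False unfolding lless_eq by blast
    then show ?thesis using nle by simp
  qed
qed

lemma flag_chain: "flag P \<Phi> \<Longrightarrow> pred_on.chain (carrier P) (le P) \<Phi>"
  by (simp add: flag_def pred_on.maxchain_def)

lemma flag_subset: "flag P \<Phi> \<Longrightarrow> \<Phi> \<subseteq> carrier P"
  using flag_chain chain_iff by blast

lemmas flag_rank_inj = chain_rank_inj[OF flag_chain]
lemmas flag_le_iff = chain_le_iff[OF flag_chain]

lemma flag_maximal: "flag P \<Phi> \<Longrightarrow> pred_on.chain (carrier P) (le P) C \<Longrightarrow> \<Phi> \<subseteq> C \<Longrightarrow> C = \<Phi>"
  unfolding flag_def pred_on.maxchain_def by blast

lemma chain_card:
  assumes "pred_on.chain (carrier P) (le P) C"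
  shows "finite C" "card C \<le> n + 2"
proof -
  have inj: "inj_on rank C" using chain_rank_inj[OF assms] by (auto intro: inj_onI)
  have sub: "rank ` C \<subseteq> {-1..int n}" using assms rank_range unfolding chain_iff by blast
  show "finite C" using finite_imageD[OF finite_subset[OF sub] inj] by simp
  have "card C \<le> card {-1..int n}" using card_inj_on_le[OF inj sub] by simp
  then show "card C \<le> n + 2" by simp
qed

text \<open>
  The rank is strictly monotone on a chain, which bounds the number of its faces by \<open>n + 2\<close>; hence among
  the chains that contain \<open>C\<close> there is a largest one.
\<close>

lemma chain_extends_to_flag:
  assumes C: "pred_on.chain (carrier P) (le P) C"
  obtains \<Phi> where "flag P \<Phi>" "C \<subseteq> \<Phi>"
proof -
  let ?Q = "\<lambda>D. pred_on.chain (carrier P) (le P) D \<and> C \<subseteq> D"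
  have "\<exists>D. ?Q D \<and> (\<forall>E. ?Q E \<longrightarrow> card E \<le> card D)"
  proof (rule ex_has_greatest_nat)
    show "?Q C" using C by simp
    show "\<forall>E. ?Q E \<longrightarrow> card E < n + 3" using chain_card(2) by fastforce
  qed
  then obtain D where D: "?Q D" and max: "\<And>E. ?Q E \<Longrightarrow> card E \<le> card D" by blast
  have "flag P D"
    unfolding flag_def pred_on.maxchain_def
  proof (intro conjI notI)
    assume "\<exists>S. pred_on.chain (carrier P) (le P) S \<and> D \<subset> S"
    then obtain E where E: "pred_on.chain (carrier P) (le P) E" "D \<subset> E" by blast
    then show False using max[of E] D psubset_card_mono[OF chain_card(1)[OF E(1)] E(2)] by force
  qed (use D in simp)
  then show thesis using that D by blast
qed

lemma chain_card_flag:
  assumes C: "pred_on.chain (carrier P) (le P) C" and card: "card C = n + 2"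
  shows "flag P C"
proof -
  obtain \<Phi> where \<Phi>: "flag P \<Phi>" "C \<subseteq> \<Phi>" by (rule chain_extends_to_flag[OF C])
  have "C = \<Phi>"
    using card_subset_eq[OF chain_card(1)[OF flag_chain[OF \<Phi>(1)]] \<Phi>(2)] card flag_card[OF \<Phi>(1)]
    by simp
  then show ?thesis using \<Phi> by simp
qed

lemma flag_rank_bij:
  assumes "flag P \<Phi>" shows "bij_betw rank \<Phi> {-1..int n}"
proof -
  have inj: "inj_on rank \<Phi>" using flag_rank_inj[OF assms] by (auto intro: inj_onI)
  have sub: "rank ` \<Phi> \<subseteq> {-1..int n}" using flag_subset[OF assms] rank_range by blast
  have "rank ` \<Phi> = {-1..int n}"
    using card_subset_eq[OF _ sub] card_image[OF inj] flag_card[OF assms] by simp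
  then show ?thesis using inj by (simp add: bij_betw_def)
qed

lemma flag_face_of_rank:
  assumes "flag P \<Phi>" "-1 \<le> i" "i \<le> int n"
  obtains F where "F \<in> \<Phi>" "rank F = i"
proof -
  have "i \<in> rank ` \<Phi>" using flag_rank_bij[OF assms(1)] assms by (simp add: bij_betw_def)
  then show thesis using that by blast
qed

lemma chain_flagI:
  assumes C: "pred_on.chain (carrier P) (le P) C" and sur: "\<And>i. -1 \<le> i \<Longrightarrow> i \<le> int n \<Longrightarrow> \<exists>F \<in> C. rank F = i"
  shows "flag P C"
  unfolding flag_def pred_on.maxchain_def
proof (intro conjI notI C)
  assume "\<exists>S. pred_on.chain (carrier P) (le P) S \<and> C \<subset> S"
  then obtain S x where S: "pred_on.chain (carrier P) (le P) S" "C \<subset> S" and x: "x \<in> S" "x \<notin> C" by blast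
  have "x \<in> carrier P" using S x chain_iff by blast
  then obtain y where "y \<in> C" "rank y = rank x" using sur rank_range by force
  then show False using chain_rank_inj[OF S(1), of x y] S x by auto
qed

text \<open>
  The face of rank \<open>i\<close> has to lie between the faces of ranks \<open>i - 1\<close> and \<open>i + 1\<close>, and the diamond
  condition leaves exactly one choice besides the given face.
\<close>

lemma unique_adjacent_flag:
  assumes \<Phi>: "flag P \<Phi>" and i: "i < n"
  shows "\<exists>!\<Psi>. flag P \<Psi> \<and> differ_exactly_at P i \<Phi> \<Psi>"
proof -
  obtain F where F: "F \<in> \<Phi>" "rank F = int i - 1" by (rule flag_face_of_rank[OF \<Phi>, of "int i - 1"]) (use i in auto)
  obtain G where G: "G \<in> \<Phi>" "rank G = int i + 1" by (rule flag_face_of_rank[OF \<Phi>, of "int i + 1"]) (use i in auto)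
  obtain H where H: "H \<in> \<Phi>" "rank H = int i" by (rule flag_face_of_rank[OF \<Phi>, of "int i"]) (use i in auto)
  define B where "B = {H \<in> carrier P. rank H = int i \<and> F \<sqsubset> H \<and> H \<sqsubset> G}"
  have c: "F \<in> carrier P" "G \<in> carrier P" "H \<in> carrier P" using F G H flag_subset[OF \<Phi>] by auto
  have FG: "F \<sqsubset> G" using flag_le_iff[OF \<Phi> F(1) G(1)] F G unfolding lless_eq by auto
  have HB: "K \<in> B" if "flag P \<Psi>" "K \<in> \<Psi>" "F \<in> \<Psi>" "G \<in> \<Psi>" "rank K = int i" for K \<Psi>
    using that F G flag_le_iff[OF that(1), of F K] flag_le_iff[OF that(1), of K G] flag_subset[OF that(1)]
    unfolding B_def lless_eq by auto
  have "card B = 2" unfolding B_def using diamond[OF c(1,2) FG F(2) G(2)] .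
  then obtain H' where B: "B = {H, H'}" "H' \<noteq> H"
    using HB[OF \<Phi> H(1) F(1) G(1) H(2)] by (auto simp: card_2_iff)
  have H': "H' \<in> carrier P" "rank H' = int i" "F \<sqsubseteq> H'" "H' \<sqsubseteq> G"
    using B unfolding B_def lless_eq by auto
  \<comment> \<open>The new flag: \<open>H\<close> is exchanged for the other face between \<open>F\<close> and \<open>G\<close>.\<close>
  define \<Psi> where "\<Psi> = insert H' (\<Phi> - {H})"
  have cmp: "x \<sqsubseteq> H' \<or> H' \<sqsubseteq> x" if "x \<in> \<Phi> - {H}" for x
  proof -
    have x: "x \<in> \<Phi>" "x \<in> carrier P" using that flag_subset[OF \<Phi>] by auto
    have "rank x \<noteq> int i" using flag_rank_inj[OF \<Phi> x(1) H(1)] H that by auto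
    then have "x \<sqsubseteq> F \<or> G \<sqsubseteq> x"
      using flag_le_iff[OF \<Phi> x(1) F(1)] flag_le_iff[OF \<Phi> G(1) x(1)] F G by auto
    then show ?thesis using le_trans[of x F H'] le_trans[of H' G x] c H' x by auto
  qed
  have ch: "pred_on.chain (carrier P) (le P) \<Psi>"
    using cmp flag_chain[OF \<Phi>] H' le_refl unfolding chain_iff \<Psi>_def by auto
  have \<Psi>: "flag P \<Psi>"
  proof (rule chain_flagI[OF ch])
    fix k assume "-1 \<le> k" "k \<le> int n"
    then obtain K where "K \<in> \<Phi>" "rank K = k" using flag_face_of_rank[OF \<Phi>] by blast
    then show "\<exists>F \<in> \<Psi>. rank F = k" using H H' unfolding \<Psi>_def by (cases "K = H") auto
  qed
  have "rank x \<noteq> int i" if "x \<in> \<Phi>" "x \<noteq> H" for x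
    using flag_rank_inj[OF \<Phi> that(1) H(1)] H(2) that(2) by metis
  then have ni: "{F \<in> \<Phi>. rank F \<noteq> int i} = \<Phi> - {H}" using H(2) by auto
  have H'n: "H' \<notin> \<Phi>" using flag_rank_inj[OF \<Phi>, of H' H] H H'(2) B(2) by metis
  have "{F \<in> \<Psi>. rank F \<noteq> int i} = {F \<in> \<Phi>. rank F \<noteq> int i}"
    unfolding \<Psi>_def using H(2) H'(2) by auto
  moreover have "H' \<in> \<Psi>" by (simp add: \<Psi>_def)
  ultimately have diff: "differ_exactly_at P i \<Phi> \<Psi>"
    unfolding differ_exactly_at_def using H'n by metis
  show ?thesis
  proof (rule ex1I, rule conjI, rule \<Psi>, rule diff)
    fix X assume X: "flag P X \<and> differ_exactly_at P i \<Phi> X"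
    then have eq: "{F \<in> X. rank F \<noteq> int i} = \<Phi> - {H}" and ne: "\<Phi> \<noteq> X" and fX: "flag P X"
      using ni unfolding differ_exactly_at_def by auto
    have FX: "F \<in> X" "G \<in> X" using eq F G H(2) by force+
    obtain K where K: "K \<in> X" "rank K = int i" by (rule flag_face_of_rank[OF fX, of "int i"]) (use i in auto)
    have "rank x \<noteq> int i" if "x \<in> X" "x \<noteq> K" for x
      using flag_rank_inj[OF fX that(1) K(1)] K(2) that(2) by metis
    then have "X = insert K {F \<in> X. rank F \<noteq> int i}" using K(1) by auto
    then have "X = insert K (\<Phi> - {H})" unfolding eq .
    moreover have "K = H \<or> K = H'" using HB[OF fX K(1) FX K(2)] B(1) by blast
    ultimately show "X = \<Psi>" using ne H(1) unfolding \<Psi>_def by (metis insert_Diff)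
  qed
qed

lemma
  assumes "flag P \<Phi>" "i < n"
  shows adjacent_flag_flag: "flag P (adjacent_flag P i \<Phi>)"
    and adjacent_flag_differ: "differ_exactly_at P i \<Phi> (adjacent_flag P i \<Phi>)"
  using theI'[OF unique_adjacent_flag[OF assms]] unfolding adjacent_flag_def by auto

lemma adjacent_flag_eq:
  "flag P \<Phi> \<Longrightarrow> i < n \<Longrightarrow> flag P \<Psi> \<Longrightarrow> differ_exactly_at P i \<Phi> \<Psi> \<Longrightarrow> adjacent_flag P i \<Phi> = \<Psi>"
  unfolding adjacent_flag_def by (intro the1_equality unique_adjacent_flag) auto

lemma adjacent_flag_involution:
  assumes "flag P \<Phi>" "i < n"
  shows "adjacent_flag P i (adjacent_flag P i \<Phi>) = \<Phi>"
  using adjacent_flag_differ[OF assms] assms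
  by (intro adjacent_flag_eq adjacent_flag_flag) (auto simp: differ_exactly_at_def)

lemma mem_adjacent_flag_iff:
  assumes "flag P \<Phi>" "i < n" "rank F \<noteq> int i"
  shows "F \<in> adjacent_flag P i \<Phi> \<longleftrightarrow> F \<in> \<Phi>"
  using adjacent_flag_differ[OF assms(1,2)] assms(3) unfolding differ_exactly_at_def by blast

text \<open>
  The two exchanges take place on opposite sides of the face of rank \<open>i + 1\<close>. The flag that takes its
  faces of rank at most \<open>i\<close> from the \<open>i\<close>-adjacent flag and the others from the \<open>j\<close>-adjacent flag is
  therefore the result of both orders of exchange.
\<close>

lemma adjacent_flag_commute:
  assumes \<Phi>: "flag P \<Phi>" and i: "i + 1 < j" "j < n"
  shows "adjacent_flag P i (adjacent_flag P j \<Phi>) = adjacent_flag P j (adjacent_flag P i \<Phi>)"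
proof -
  let ?A = "adjacent_flag P i \<Phi>" and ?B = "adjacent_flag P j \<Phi>"
  have i': "i < n" "i \<noteq> j" using i by auto
  have A: "flag P ?A" and B: "flag P ?B" using adjacent_flag_flag \<Phi> i by auto
  note memA = mem_adjacent_flag_iff[OF \<Phi> i'(1)] and memB = mem_adjacent_flag_iff[OF \<Phi> i(2)]
  obtain M where M: "M \<in> \<Phi>" "rank M = int i + 1"
    by (rule flag_face_of_rank[OF \<Phi>, of "int i + 1"]) (use i in auto)
  have MA: "M \<in> ?A" and MB: "M \<in> ?B" using memA memB M i by auto
  \<comment> \<open>The lower faces of one adjacent flag are comparable with the upper faces of the other through \<open>M\<close>.\<close>
  define X where "X = {F \<in> ?A. rank F \<le> int i} \<union> {F \<in> ?B. int i < rank F}"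
  have cross: "x \<sqsubseteq> y" if "x \<in> ?A" "rank x \<le> int i" "y \<in> ?B" "int i < rank y" for x y
  proof -
    have "x \<sqsubseteq> M" using flag_le_iff[OF A that(1) MA] M that by simp
    moreover have "M \<sqsubseteq> y" using flag_le_iff[OF B MB that(3)] M that by simp
    ultimately show ?thesis using le_trans[of x M y] that M flag_subset[OF A] flag_subset[OF B] flag_subset[OF \<Phi>] by blast
  qed
  have ch: "pred_on.chain (carrier P) (le P) X"
    using cross flag_chain[OF A] flag_chain[OF B] unfolding chain_iff X_def by (auto; blast)
  have X: "flag P X"
  proof (rule chain_flagI[OF ch])
    fix k assume k: "-1 \<le> k" "k \<le> int n"
    obtain a where "a \<in> ?A" "rank a = k" using flag_face_of_rank[OF A k] by blast
    moreover obtain b where "b \<in> ?B" "rank b = k" using flag_face_of_rank[OF B k] by blast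
    ultimately show "\<exists>F \<in> X. rank F = k" unfolding X_def by (cases "k \<le> int i") auto
  qed
  have eqB: "{F \<in> ?B. rank F \<noteq> int i} = {F \<in> X. rank F \<noteq> int i}"
  proof (rule Set.set_eqI)
    fix x
    show "x \<in> {F \<in> ?B. rank F \<noteq> int i} \<longleftrightarrow> x \<in> {F \<in> X. rank F \<noteq> int i}"
      unfolding X_def using memA[of x] memB[of x] i by (cases "rank x \<le> int i") auto
  qed
  have eqA: "{F \<in> ?A. rank F \<noteq> int j} = {F \<in> X. rank F \<noteq> int j}"
  proof (rule Set.set_eqI)
    fix x
    show "x \<in> {F \<in> ?A. rank F \<noteq> int j} \<longleftrightarrow> x \<in> {F \<in> X. rank F \<noteq> int j}"
      unfolding X_def using memA[of x] memB[of x] i by (cases "rank x \<le> int i") auto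
  qed
  obtain a where a: "a \<in> ?A" "rank a = int i" by (rule flag_face_of_rank[OF A, of "int i"]) (use i in auto)
  obtain b where b: "b \<in> ?B" "rank b = int j" by (rule flag_face_of_rank[OF B, of "int j"]) (use i in auto)
  have an: "a \<notin> \<Phi>"
  proof
    assume "a \<in> \<Phi>"
    then have "?A \<subseteq> \<Phi>" using a memA flag_rank_inj[OF A _ a(1)] by (metis subsetI)
    then show False using flag_maximal[OF A flag_chain[OF \<Phi>]] adjacent_flag_differ[OF \<Phi> i'(1)]
      by (simp add: differ_exactly_at_def)
  qed
  have bn: "b \<notin> \<Phi>"
  proof
    assume "b \<in> \<Phi>"
    then have "?B \<subseteq> \<Phi>" using b memB flag_rank_inj[OF B _ b(1)] by (metis subsetI)
    then show False using flag_maximal[OF B flag_chain[OF \<Phi>]] adjacent_flag_differ[OF \<Phi> i(2)]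
      by (simp add: differ_exactly_at_def)
  qed
  have "a \<in> X" "a \<notin> ?B" "b \<in> X" "b \<notin> ?A"
    using a b an bn memA memB i unfolding X_def by auto
  then have "?B \<noteq> X" "?A \<noteq> X" by auto
  then have "adjacent_flag P i ?B = X" "adjacent_flag P j ?A = X"
    using adjacent_flag_eq[OF B i'(1) X] adjacent_flag_eq[OF A i(2) X] eqA eqB
    unfolding differ_exactly_at_def by simp_all
  then show ?thesis by simp
qed

text \<open>
  A flag has one face of each rank, so the two faces in which adjacent flags differ have the same rank;
  the uniqueness of the least and of the greatest face makes it a proper one.
\<close>

lemma adjacent_imp_adjacent_flag:
  assumes X: "flag P X" and Y: "flag P Y" and adj: "adjacent X Y"
  obtains i where "i < n" "Y = adjacent_flag P i X"
proof -
  obtain a where a: "X - Y = {a}" using adj by (auto simp: adjacent_def card_1_singleton_iff)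
  obtain b where b: "Y - X = {b}" using adj by (auto simp: adjacent_def card_1_singleton_iff)
  have c: "a \<in> carrier P" "b \<in> carrier P" using a b flag_subset[OF X] flag_subset[OF Y] by auto
  have rab: "rank b = rank a"
  proof -
    obtain y where y: "y \<in> Y" "rank y = rank a"
      using flag_face_of_rank[OF Y, of "rank a"] rank_range[OF c(1)] by auto
    have "y \<notin> X"
    proof
      assume "y \<in> X"
      then have "y = a" using flag_rank_inj[OF X, of y a] a y(2) by blast
      then show False using a y(1) by blast
    qed
    then show ?thesis using y b by auto
  qed
  have "rank a \<noteq> -1"
  proof
    assume r: "rank a = -1"
    obtain L where L: "least P L (carrier P)" "rank L = -1" using least_face by blast
    have "L = x" if "x \<in> carrier P" "rank x = -1" for x
      using L that rank_less[of L x] unfolding least_def Lower_def lless_eq by auto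
    from this[of a] this[of b] show False using a b c r rab by auto
  qed
  moreover have "rank a \<noteq> int n"
  proof
    assume r: "rank a = int n"
    obtain L where L: "greatest P L (carrier P)" "rank L = int n" using greatest_face by blast
    have "L = x" if "x \<in> carrier P" "rank x = int n" for x
      using L that rank_less[of x L] unfolding greatest_def Upper_def lless_eq by auto
    from this[of a] this[of b] show False using a b c r rab by auto
  qed
  ultimately have r: "0 \<le> rank a" "rank a < int n" using rank_range[OF c(1)] by auto
  define i where "i = nat (rank a)"
  have i: "i < n" "rank a = int i" "rank b = int i" using r rab by (auto simp: i_def)
  have ra: "rank x \<noteq> int i" if "x \<in> X" "x \<noteq> a" for x
    using flag_rank_inj[OF X that(1), of a] a i(2) that(2) by (metis DiffD1 insertI1)
  have rb: "rank x \<noteq> int i" if "x \<in> Y" "x \<noteq> b" for x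
    using flag_rank_inj[OF Y that(1), of b] b i(3) that(2) by (metis DiffD1 insertI1)
  have "differ_exactly_at P i X Y"
    unfolding differ_exactly_at_def
  proof (intro conjI Set.set_eqI)
    show "X \<noteq> Y" using a by auto
    fix x
    show "x \<in> {F \<in> X. rank F \<noteq> int i} \<longleftrightarrow> x \<in> {F \<in> Y. rank F \<noteq> int i}"
      using a b i ra rb by (cases "x = a"; cases "x = b") auto
  qed
  then show thesis using that i adjacent_flag_eq[OF X i(1) Y] by auto
qed

text \<open>
  The form in which flag-connectivity is used: a property that passes from a flag to its adjacent flags
  and holds for one flag holds for all.
\<close>

lemma flag_induct [consumes 2, case_names base step]:
  assumes \<Phi>: "flag P \<Phi>" and \<Psi>: "flag P \<Psi>" and base: "Q \<Phi>"
    and step: "\<And>X i. flag P X \<Longrightarrow> i < n \<Longrightarrow> Q X \<Longrightarrow> Q (adjacent_flag P i X)"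
  shows "Q \<Psi>"
proof -
  have "(\<lambda>X Y. flag P X \<and> flag P Y \<and> adjacent X Y \<and> \<Phi> \<inter> \<Psi> \<subseteq> X \<and> \<Phi> \<inter> \<Psi> \<subseteq> Y)\<^sup>*\<^sup>* \<Phi> \<Psi>"
    using strong_flag_connectivity \<Phi> \<Psi> unfolding strongly_flag_connected_def by blast
  then show ?thesis
  proof (induction rule: rtranclp_induct)
    case base
    show ?case by (fact assms(3))
  next
    case (step X Y)
    then obtain i where "i < n" "Y = adjacent_flag P i X"
      using adjacent_imp_adjacent_flag[of X Y] by metis
    with step show ?case using assms(4)[of X i] by simp
  qed
qed

end

section \<open>Automorphisms of a polytope\<close>

lemma aut_group_iff:
  "\<gamma> \<in> carrier (aut_group P) \<longleftrightarrow> \<gamma> \<in> Bij (carrier P) \<and> order_emb P P \<gamma>"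
  by (simp add: aut_group_def)

lemma one_aut_group: "\<one>\<^bsub>aut_group P\<^esub> = (\<lambda>x \<in> carrier P. x)"
  by (simp add: aut_group_def BijGroup_def)

lemma mult_aut_group:
  "\<gamma> \<in> carrier (aut_group P) \<Longrightarrow> \<delta> \<in> carrier (aut_group P) \<Longrightarrow>
    \<gamma> \<otimes>\<^bsub>aut_group P\<^esub> \<delta> = compose (carrier P) \<gamma> \<delta>"
  by (simp add: aut_group_def BijGroup_def)

context weak_partial_order
begin

lemma group_aut_group: "group (aut_group L)"
proof -
  let ?A = "{f \<in> Bij (carrier L). order_emb L L f}"
  have "subgroup ?A (BijGroup (carrier L))"
  proof (rule group.subgroupI[OF group_BijGroup])
    show "?A \<subseteq> carrier (BijGroup (carrier L))" by (auto simp: BijGroup_def)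
    show "?A \<noteq> {}"
      using id_Bij[of "carrier L"] weak_partial_order_axioms unfolding order_emb_def by force
  next
    fix f assume f: "f \<in> ?A"
    let ?g = "\<lambda>x \<in> carrier L. inv_into (carrier L) f x"
    have im: "f ` carrier L = carrier L" using f by (auto simp: Bij_def bij_betw_def)
    have inj: "inj_on f (carrier L)" using f by (auto simp: Bij_def bij_betw_def)
    have "?g x \<sqsubseteq> ?g y \<longleftrightarrow> x \<sqsubseteq> y" if xy: "x \<in> carrier L" "y \<in> carrier L" for x y
    proof -
      obtain a b where ab: "a \<in> carrier L" "b \<in> carrier L" "x = f a" "y = f b"
        using xy im by (metis imageE)
      then have "?g x = a" "?g y = b" using xy inv_into_f_f[OF inj] by auto
      then show ?thesis using f ab unfolding order_emb_def by simp
    qed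
    then have "order_emb L L ?g" using weak_partial_order_axioms unfolding order_emb_def by blast
    then show "inv\<^bsub>BijGroup (carrier L)\<^esub> f \<in> ?A"
      using f restrict_inv_into_Bij inv_BijGroup by (metis (no_types, lifting) mem_Collect_eq)
  next
    fix f g assume fg: "f \<in> ?A" "g \<in> ?A"
    then have "g x \<in> carrier L" if "x \<in> carrier L" for x
      using that Bij_imp_funcset by fastforce
    then show "f \<otimes>\<^bsub>BijGroup (carrier L)\<^esub> g \<in> ?A"
      using fg compose_Bij by (auto simp: BijGroup_def order_emb_def compose_eq)
  qed
  then show ?thesis
    unfolding aut_group_def by (rule group.subgroup_imp_group[OF group_BijGroup])
qed

lemma aut_mem: "\<gamma> \<in> carrier (aut_group L) \<Longrightarrow> x \<in> carrier L \<Longrightarrow> \<gamma> x \<in> carrier L"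
  using Bij_imp_funcset[of \<gamma>] by (auto simp: aut_group_iff)

lemma aut_le_iff:
  "\<gamma> \<in> carrier (aut_group L) \<Longrightarrow> x \<in> carrier L \<Longrightarrow> y \<in> carrier L \<Longrightarrow> \<gamma> x \<sqsubseteq> \<gamma> y \<longleftrightarrow> x \<sqsubseteq> y"
  by (simp add: aut_group_iff order_emb_def)

lemma aut_mult_image:
  assumes "\<gamma> \<in> carrier (aut_group L)" "\<delta> \<in> carrier (aut_group L)" "X \<subseteq> carrier L"
  shows "(\<gamma> \<otimes>\<^bsub>aut_group L\<^esub> \<delta>) ` X = \<gamma> ` \<delta> ` X"
  unfolding mult_aut_group[OF assms(1,2)] image_image
  using assms(3) by (intro image_cong refl) (auto simp: compose_eq)

lemma aut_one_image: "X \<subseteq> carrier L \<Longrightarrow> \<one>\<^bsub>aut_group L\<^esub> ` X = X"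
  unfolding one_aut_group by (auto simp: image_iff)

end

context polytope
begin

abbreviation "Aut \<equiv> carrier (aut_group P)"

sublocale aut: group "aut_group P" by (rule group_aut_group)

lemma aut_inj: "\<gamma> \<in> Aut \<Longrightarrow> inj_on \<gamma> (carrier P)"
  by (auto simp: aut_group_iff Bij_def bij_betw_def)

lemma aut_flag:
  assumes \<gamma>: "\<gamma> \<in> Aut" and \<Phi>: "flag P \<Phi>"
  shows "flag P (\<gamma> ` \<Phi>)"
proof (rule chain_card_flag)
  note sub = flag_subset[OF \<Phi>]
  show "pred_on.chain (carrier P) (\<sqsubseteq>) (\<gamma> ` \<Phi>)"
    unfolding chain_iff
  proof (intro conjI ballI)
    show "\<gamma> ` \<Phi> \<subseteq> carrier P" using aut_mem[OF \<gamma>] sub by blast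
    fix x y assume "x \<in> \<gamma> ` \<Phi>" "y \<in> \<gamma> ` \<Phi>"
    then obtain a b where "a \<in> \<Phi>" "b \<in> \<Phi>" "x = \<gamma> a" "y = \<gamma> b" by blast
    moreover from this have "a \<sqsubseteq> b \<or> b \<sqsubseteq> a"
      using flag_chain[OF \<Phi>] unfolding chain_iff by simp
    moreover have "a \<in> carrier P" "b \<in> carrier P" using \<open>a \<in> \<Phi>\<close> \<open>b \<in> \<Phi>\<close> sub by auto
    ultimately show "x \<sqsubseteq> y \<or> y \<sqsubseteq> x" by (simp add: aut_le_iff[OF \<gamma>])
  qed
  show "card (\<gamma> ` \<Phi>) = n + 2"
    using card_image[OF inj_on_subset[OF aut_inj[OF \<gamma>] sub]] flag_card[OF \<Phi>] by simp
qed

lemma face_in_flag: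
  assumes "F \<in> carrier P" obtains \<Phi> where "flag P \<Phi>" "F \<in> \<Phi>"
proof -
  have "pred_on.chain (carrier P) (\<sqsubseteq>) {F}" using assms unfolding chain_iff by simp
  then show thesis using chain_extends_to_flag that by blast
qed

text \<open>
  This expresses the rank in terms of the order alone, so that automorphisms, which respect
  only the order by definition, preserve the rank.
\<close>

lemma flag_rank_eq_card:
  assumes \<Phi>: "flag P \<Phi>" and F: "F \<in> \<Phi>"
  shows "rank F = int (card {G \<in> \<Phi>. G \<sqsubseteq> F}) - 2"
proof -
  have bij: "bij_betw rank \<Phi> {-1..int n}" by (rule flag_rank_bij[OF \<Phi>])
  have rF: "-1 \<le> rank F" "rank F \<le> int n" using rank_range flag_subset[OF \<Phi>] F by force+
  have "{G \<in> \<Phi>. G \<sqsubseteq> F} = {G \<in> \<Phi>. rank G \<le> rank F}"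
    using flag_le_iff[OF \<Phi> _ F] by blast
  moreover have "rank ` {G \<in> \<Phi>. rank G \<le> rank F} = {-1..rank F}"
  proof (intro equalityI subsetI)
    fix k assume k: "k \<in> {-1..rank F}"
    then obtain G where "G \<in> \<Phi>" "rank G = k" using flag_face_of_rank[OF \<Phi>, of k] rF by auto
    then show "k \<in> rank ` {G \<in> \<Phi>. rank G \<le> rank F}" using k by auto
  qed (use bij in \<open>auto simp: bij_betw_def\<close>)
  moreover have "inj_on rank {G \<in> \<Phi>. rank G \<le> rank F}"
    by (rule inj_on_subset[of rank \<Phi>]) (use bij in \<open>auto simp: bij_betw_def\<close>)
  ultimately have "card {G \<in> \<Phi>. G \<sqsubseteq> F} = card {-1..rank F}"
    using card_image by metis
  then show ?thesis using rF by simp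
qed

lemma aut_rank:
  assumes \<gamma>: "\<gamma> \<in> Aut" and F: "F \<in> carrier P"
  shows "rank (\<gamma> F) = rank F"
proof -
  obtain \<Phi> where \<Phi>: "flag P \<Phi>" "F \<in> \<Phi>" by (rule face_in_flag[OF F])
  note sub = flag_subset[OF \<Phi>(1)]
  have "{G \<in> \<gamma> ` \<Phi>. G \<sqsubseteq> \<gamma> F} = \<gamma> ` {G \<in> \<Phi>. G \<sqsubseteq> F}"
    using aut_le_iff[OF \<gamma> _ F] sub by blast
  moreover have "inj_on \<gamma> {G \<in> \<Phi>. G \<sqsubseteq> F}"
    by (rule inj_on_subset[OF aut_inj[OF \<gamma>]]) (use sub in auto)
  ultimately have "card {G \<in> \<gamma> ` \<Phi>. G \<sqsubseteq> \<gamma> F} = card {G \<in> \<Phi>. G \<sqsubseteq> F}"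
    using card_image by metis
  then show ?thesis
    using flag_rank_eq_card[OF \<Phi>] flag_rank_eq_card[OF aut_flag[OF \<gamma> \<Phi>(1)], of "\<gamma> F"] \<Phi>(2) by simp
qed

lemma aut_adjacent_flag:
  assumes \<gamma>: "\<gamma> \<in> Aut" and \<Phi>: "flag P \<Phi>" and i: "i < n"
  shows "\<gamma> ` adjacent_flag P i \<Phi> = adjacent_flag P i (\<gamma> ` \<Phi>)"
proof -
  let ?\<Psi> = "adjacent_flag P i \<Phi>"
  have \<Psi>: "flag P ?\<Psi>" "differ_exactly_at P i \<Phi> ?\<Psi>"
    using adjacent_flag_flag adjacent_flag_differ \<Phi> i by auto
  have im: "{F \<in> \<gamma> ` X. rank F \<noteq> int i} = \<gamma> ` {F \<in> X. rank F \<noteq> int i}" if "X \<subseteq> carrier P" for X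
    using aut_rank[OF \<gamma>] that by force
  have "differ_exactly_at P i (\<gamma> ` \<Phi>) (\<gamma> ` ?\<Psi>)"
    using \<Psi>(2) im[OF flag_subset[OF \<Phi>]] im[OF flag_subset[OF \<Psi>(1)]]
      inj_on_image_eq_iff[OF aut_inj[OF \<gamma>] flag_subset[OF \<Phi>] flag_subset[OF \<Psi>(1)]]
    unfolding differ_exactly_at_def by simp
  then show ?thesis using adjacent_flag_eq aut_flag[OF \<gamma>] \<Phi> \<Psi>(1) i by metis
qed

lemma aut_fixing_flag_fixes_faces:
  assumes \<gamma>: "\<gamma> \<in> Aut" and \<Phi>: "flag P \<Phi>" "\<gamma> ` \<Phi> = \<Phi>" and F: "F \<in> \<Phi>"
  shows "\<gamma> F = F"
proof (rule flag_rank_inj[OF \<Phi>(1) _ F])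
  show "\<gamma> F \<in> \<Phi>" using \<Phi>(2) F by blast
  show "rank (\<gamma> F) = rank F" using aut_rank[OF \<gamma>] flag_subset[OF \<Phi>(1)] F by blast
qed

text \<open>
  An automorphism that fixes a flag fixes its adjacent flags, as these are unique; by connectivity it
  fixes every flag, and every face lies in a flag.
\<close>

lemma aut_fixing_flag_is_one:
  assumes \<gamma>: "\<gamma> \<in> Aut" and \<Phi>: "flag P \<Phi>" "\<gamma> ` \<Phi> = \<Phi>"
  shows "\<gamma> = \<one>\<^bsub>aut_group P\<^esub>"
proof -
  have all: "\<gamma> ` \<Psi> = \<Psi>" if "flag P \<Psi>" for \<Psi>
    using \<Phi>(1) that
  proof (induction rule: flag_induct)
    case (step X i)
    then show ?case using aut_adjacent_flag[OF \<gamma>, of X i] by simp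
  qed (rule \<Phi>(2))
  have "\<gamma> F = F" if "F \<in> carrier P" for F
    using face_in_flag[OF that] all aut_fixing_flag_fixes_faces[OF \<gamma>] by metis
  moreover have "\<gamma> \<in> extensional (carrier P)"
    using \<gamma> by (simp add: aut_group_iff Bij_imp_extensional)
  ultimately show ?thesis
    unfolding one_aut_group by (intro extensionalityI[of _ "carrier P"]) auto
qed

lemma aut_eqI:
  assumes \<gamma>: "\<gamma> \<in> Aut" and \<delta>: "\<delta> \<in> Aut" and \<Phi>: "flag P \<Phi>" and eq: "\<gamma> ` \<Phi> = \<delta> ` \<Phi>"
  shows "\<gamma> = \<delta>"
proof -
  note sub = flag_subset[OF \<Phi>]
  have i: "inv\<^bsub>aut_group P\<^esub> \<delta> \<in> Aut" using \<delta> by simp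
  have "(inv\<^bsub>aut_group P\<^esub> \<delta> \<otimes>\<^bsub>aut_group P\<^esub> \<gamma>) ` \<Phi> = (inv\<^bsub>aut_group P\<^esub> \<delta> \<otimes>\<^bsub>aut_group P\<^esub> \<delta>) ` \<Phi>"
    using eq aut_mult_image[OF i \<gamma> sub] aut_mult_image[OF i \<delta> sub] by simp
  also have "\<dots> = \<Phi>" using aut.l_inv[OF \<delta>] aut_one_image[OF sub] by simp
  finally have "inv\<^bsub>aut_group P\<^esub> \<delta> \<otimes>\<^bsub>aut_group P\<^esub> \<gamma> = \<one>\<^bsub>aut_group P\<^esub>"
    using aut_fixing_flag_is_one \<Phi> aut.m_closed[OF i \<gamma>] by blast
  then show ?thesis using \<gamma> \<delta> by (metis aut.inv_inv aut.inv_closed aut.inv_equality)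
qed

end

section \<open>Distinguished generators of the group of a regular polytope\<close>

locale regular_polytope = polytope +
  fixes \<Phi> :: "'a set"
  assumes regular: "regular P" and base_flag: "flag P \<Phi>"
begin

abbreviation "rho \<equiv> \<rho> P \<Phi>"
abbreviation "rotations \<equiv> carrier (rotation_group n P \<Phi>)"

lemma rho:
  assumes i: "i < n"
  shows "rho i \<in> Aut" "rho i ` \<Phi> = adjacent_flag P i \<Phi>"
proof -
  note adj = adjacent_flag_flag[OF base_flag i] adjacent_flag_differ[OF base_flag i]
  obtain \<gamma> where \<gamma>: "\<gamma> \<in> Aut" "\<gamma> ` \<Phi> = adjacent_flag P i \<Phi>"
    using regular base_flag adj(1) unfolding regular_def by blast
  have "rho i = \<gamma>"
    unfolding \<rho>_def
  proof (rule the_equality)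
    fix \<delta> assume "\<delta> \<in> Aut \<and> flag P (\<delta> ` \<Phi>) \<and> differ_exactly_at P i \<Phi> (\<delta> ` \<Phi>)"
    then show "\<delta> = \<gamma>" using \<gamma> aut_eqI[of \<delta> \<gamma>, OF _ _ base_flag] adjacent_flag_eq[OF base_flag i] by metis
  qed (use \<gamma> adj in simp)
  then show "rho i \<in> Aut" "rho i ` \<Phi> = adjacent_flag P i \<Phi>" using \<gamma> by auto
qed

text \<open>
  Right multiplication by \<open>\<rho>\<^sub>i\<close> is a step from the flag \<open>\<gamma> \<Phi>\<close> to the flag \<open>i\<close>-adjacent to it. Thus
  words in the \<open>\<rho>\<^sub>i\<close> are walks in the flag graph that start at the base flag.
\<close>

lemma rho_mult_image:
  assumes "\<gamma> \<in> Aut" "i < n"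
  shows "(\<gamma> \<otimes>\<^bsub>aut_group P\<^esub> rho i) ` \<Phi> = adjacent_flag P i (\<gamma> ` \<Phi>)"
  using aut_mult_image[OF assms(1) rho(1)[OF assms(2)] flag_subset[OF base_flag]]
    rho(2)[OF assms(2)] aut_adjacent_flag[OF assms(1) base_flag assms(2)] by simp

lemma rho_involution:
  assumes i: "i < n" shows "rho i \<otimes>\<^bsub>aut_group P\<^esub> rho i = \<one>\<^bsub>aut_group P\<^esub>"
  using rho_mult_image[OF rho(1)[OF i] i] rho[OF i] adjacent_flag_involution[OF base_flag i]
  by (intro aut_fixing_flag_is_one[OF _ base_flag]) simp_all

lemma rho_commute:
  assumes ij: "i + 1 < j" "j < n"
  shows "rho i \<otimes>\<^bsub>aut_group P\<^esub> rho j = rho j \<otimes>\<^bsub>aut_group P\<^esub> rho i"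
proof (rule aut_eqI[OF _ _ base_flag])
  have i: "i < n" using ij by simp
  note r = rho[OF i] rho[OF ij(2)]
  show "rho i \<otimes>\<^bsub>aut_group P\<^esub> rho j \<in> Aut" "rho j \<otimes>\<^bsub>aut_group P\<^esub> rho i \<in> Aut"
    using r by simp_all
  show "(rho i \<otimes>\<^bsub>aut_group P\<^esub> rho j) ` \<Phi> = (rho j \<otimes>\<^bsub>aut_group P\<^esub> rho i) ` \<Phi>"
    using rho_mult_image[OF r(1) ij(2)] rho_mult_image[OF r(3) i] r
      adjacent_flag_commute[OF base_flag ij] by simp
qed

lemma rho_subset: "rho ` {..<n} \<subseteq> Aut"
  using rho(1) by auto

text \<open>
  A walk from \<open>\<Phi>\<close> to \<open>\<gamma> \<Phi>\<close> spells a word in the \<open>\<rho>\<^sub>i\<close> that has the same effect on \<open>\<Phi>\<close> as \<open>\<gamma>\<close>, and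
  automorphisms are determined by their effect on one flag.
\<close>

lemma aut_generated: "Aut = generate (aut_group P) (rho ` {..<n})"
proof (intro equalityI subsetI)
  fix \<gamma> assume \<gamma>: "\<gamma> \<in> Aut"
  have "\<exists>\<delta> \<in> generate (aut_group P) (rho ` {..<n}). \<delta> ` \<Phi> = \<gamma> ` \<Phi>"
    using base_flag aut_flag[OF \<gamma> base_flag]
  proof (induction rule: flag_induct)
    case base
    show ?case using generate.one aut_one_image[OF flag_subset[OF base_flag]] by blast
  next
    case (step X i)
    then obtain \<delta> where \<delta>: "\<delta> \<in> generate (aut_group P) (rho ` {..<n})" "\<delta> ` \<Phi> = X" by blast
    then have "\<delta> \<in> Aut" using aut.generate_in_carrier[OF rho_subset] by blast
    then have "(\<delta> \<otimes>\<^bsub>aut_group P\<^esub> rho i) ` \<Phi> = adjacent_flag P i X"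
      using rho_mult_image \<delta> step by simp
    moreover have "\<delta> \<otimes>\<^bsub>aut_group P\<^esub> rho i \<in> generate (aut_group P) (rho ` {..<n})"
      using generate.eng[OF \<delta>(1) generate.incl] step(2) by blast
    ultimately show ?case by blast
  qed
  then show "\<gamma> \<in> generate (aut_group P) (rho ` {..<n})"
    using aut_eqI[OF \<gamma> _ base_flag] aut.generate_in_carrier[OF rho_subset] by metis
qed (use aut.generate_in_carrier[OF rho_subset] in blast)

text \<open>
  The generator \<open>\<rho>\<^sub>i\<close> moves only the \<open>i\<close>-face of the base flag.
\<close>

lemma stabilizer:
  assumes I: "I \<subseteq> {..<n}" and \<gamma>: "\<gamma> \<in> generate (aut_group P) (rho ` I)"
    and F: "F \<in> \<Phi>" "rank F \<notin> int ` I"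
  shows "\<gamma> F = F"
proof -
  have sub: "rho ` I \<subseteq> Aut" using I rho(1) by auto
  have Fc: "F \<in> carrier P" using F flag_subset[OF base_flag] by blast
  show ?thesis
    using \<gamma> sub
  proof (rule aut.generate_involutions_induct)
    show "\<one>\<^bsub>aut_group P\<^esub> F = F" using Fc by (simp add: one_aut_group)
  next
    fix s assume "s \<in> rho ` I"
    then show "s \<otimes>\<^bsub>aut_group P\<^esub> s = \<one>\<^bsub>aut_group P\<^esub>" using rho_involution I by auto
  next
    fix \<delta> s
    assume \<delta>: "\<delta> \<in> generate (aut_group P) (rho ` I)" "\<delta> F = F" and "s \<in> rho ` I"
    then obtain i where i: "s = rho i" "i \<in> I" "i < n" using I by auto
    have "F \<in> adjacent_flag P i \<Phi>"
      using mem_adjacent_flag_iff[OF base_flag i(3)] F i(2) by auto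
    moreover have "rho i F \<in> adjacent_flag P i \<Phi>" using rho(2)[OF i(3)] F(1) by blast
    moreover have "rank (rho i F) = rank F" using aut_rank rho(1)[OF i(3)] Fc by blast
    ultimately have "rho i F = F"
      using flag_rank_inj[OF adjacent_flag_flag[OF base_flag i(3)]] by blast
    moreover have "\<delta> \<in> Aut" using \<delta>(1) aut.generate_in_carrier[OF sub] by blast
    ultimately show "(\<delta> \<otimes>\<^bsub>aut_group P\<^esub> s) F = F"
      using \<delta>(2) Fc i rho(1)[OF i(3)] by (simp add: mult_aut_group compose_eq)
  qed
qed

lemma fixing_all_but_one_face:
  assumes \<gamma>: "\<gamma> \<in> Aut" and k: "k < n" and fixed: "\<And>F. F \<in> \<Phi> \<Longrightarrow> rank F \<noteq> int k \<Longrightarrow> \<gamma> F = F"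
  shows "\<gamma> = \<one>\<^bsub>aut_group P\<^esub> \<or> \<gamma> = rho k"
proof (cases "\<gamma> ` \<Phi> = \<Phi>")
  case True
  then show ?thesis using aut_fixing_flag_is_one[OF \<gamma> base_flag] by simp
next
  case False
  have "{F \<in> \<gamma> ` \<Phi>. rank F \<noteq> int k} = {F \<in> \<Phi>. rank F \<noteq> int k}"
  proof (rule Set.set_eqI)
    fix F
    show "F \<in> {F \<in> \<gamma> ` \<Phi>. rank F \<noteq> int k} \<longleftrightarrow> F \<in> {F \<in> \<Phi>. rank F \<noteq> int k}"
      using aut_rank[OF \<gamma>] flag_subset[OF base_flag] fixed by (auto simp: image_iff) (metis subsetD)+
  qed
  then have "adjacent_flag P k \<Phi> = \<gamma> ` \<Phi>"
    using False adjacent_flag_eq[OF base_flag k aut_flag[OF \<gamma> base_flag]]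
    unfolding differ_exactly_at_def by simp
  then show ?thesis using aut_eqI[OF \<gamma> rho(1)[OF k] base_flag] rho(2)[OF k] by simp
qed

lemma sigma_closed: "\<sigma> P \<Phi> ` {1..n - 1} \<subseteq> Aut"
  using rho(1) unfolding \<sigma>_def by auto

lemma rotations_eq: "rotations = generate (aut_group P) (\<sigma> P \<Phi> ` {1..n - 1})"
  unfolding rotation_group_def carrier_subgroup_generated using sigma_closed by (simp add: inf.absorb2)

lemma rotations_subgroup: "subgroup rotations (aut_group P)"
  unfolding rotations_eq by (rule aut.generate_is_subgroup[OF sigma_closed])

lemma rho_rho_0: "i < n \<Longrightarrow> rho i \<otimes>\<^bsub>aut_group P\<^esub> rho 0 \<in> rotations"
proof (induction i)
  case 0
  then show ?case using rho_involution subgroup.one_closed[OF rotations_subgroup] by simp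
next
  case (Suc i)
  then have i: "i < n" "0 < n" by auto
  note c = rho(1)[OF Suc.prems] rho(1)[OF i(1)] rho(1)[OF i(2)]
  have "\<sigma> P \<Phi> (Suc i) \<in> rotations"
    unfolding rotations_eq using Suc.prems by (intro generate.incl imageI) auto
  then have "inv\<^bsub>aut_group P\<^esub> (rho i \<otimes>\<^bsub>aut_group P\<^esub> rho (Suc i)) \<in> rotations"
    using subgroup.m_inv_closed[OF rotations_subgroup] by (simp add: \<sigma>_def)
  moreover have "inv\<^bsub>aut_group P\<^esub> (rho i \<otimes>\<^bsub>aut_group P\<^esub> rho (Suc i)) = rho (Suc i) \<otimes>\<^bsub>aut_group P\<^esub> rho i"
    using c rho_involution[OF i(1)] rho_involution[OF Suc.prems]
    by (simp add: aut.inv_mult_group aut.inv_equality)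
  ultimately have "(rho (Suc i) \<otimes>\<^bsub>aut_group P\<^esub> rho i) \<otimes>\<^bsub>aut_group P\<^esub> (rho i \<otimes>\<^bsub>aut_group P\<^esub> rho 0) \<in> rotations"
    using Suc.IH[OF i(1)] subgroup.m_closed[OF rotations_subgroup] by metis
  moreover have "(rho (Suc i) \<otimes>\<^bsub>aut_group P\<^esub> rho i) \<otimes>\<^bsub>aut_group P\<^esub> (rho i \<otimes>\<^bsub>aut_group P\<^esub> rho 0)
      = rho (Suc i) \<otimes>\<^bsub>aut_group P\<^esub> (rho i \<otimes>\<^bsub>aut_group P\<^esub> rho i) \<otimes>\<^bsub>aut_group P\<^esub> rho 0"
    using c by (simp add: aut.m_assoc)
  ultimately show ?case using rho_involution[OF i(1)] c by simp
qed

text \<open>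
  The rotation subgroup has index at most 2, because it contains all products \<open>\<rho>\<^sub>i \<rho>\<^sub>0\<close>.
\<close>

lemma rotations_or_reflected:
  assumes n: "0 < n" and \<gamma>: "\<gamma> \<in> Aut"
  shows "\<gamma> \<in> rotations \<or> \<gamma> \<otimes>\<^bsub>aut_group P\<^esub> rho 0 \<in> rotations"
  unfolding rotations_eq
proof (rule aut.generate_products_of_involutions[of "rho ` {..<n}"])
  show "\<gamma> \<in> generate (aut_group P) (rho ` {..<n})" using \<gamma> aut_generated by simp
qed (use n rho_involution rho_subset sigma_closed rho_rho_0 in \<open>auto simp: rotations_eq\<close>)

text \<open>
  The cosets of the rotation subgroup are the subgroup itself and its coset by \<open>\<rho>\<^sub>0\<close>, so the index is 2
  exactly if these differ. The equivalence is used in both directions: to extract a parity from the two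
  given polyhedra, and to verify direct regularity of the mix.
\<close>

lemma rotation_index_2_iff:
  assumes n: "0 < n"
  shows "card (rcosets\<^bsub>aut_group P\<^esub> rotations) = 2 \<longleftrightarrow> rho 0 \<notin> rotations"
proof
  assume c: "card (rcosets\<^bsub>aut_group P\<^esub> rotations) = 2"
  show "rho 0 \<notin> rotations"
  proof
    assume r0: "rho 0 \<in> rotations"
    have "\<gamma> \<in> rotations" if "\<gamma> \<in> Aut" for \<gamma>
    proof (rule ccontr)
      assume "\<gamma> \<notin> rotations"
      then have "(\<gamma> \<otimes>\<^bsub>aut_group P\<^esub> rho 0) \<otimes>\<^bsub>aut_group P\<^esub> rho 0 \<in> rotations"
        using rotations_or_reflected[OF n that] r0 subgroup.m_closed[OF rotations_subgroup] by blast
      then show False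
        using \<open>\<gamma> \<notin> rotations\<close> that rho(1)[OF n] rho_involution[OF n] by (simp add: aut.m_assoc)
    qed
    then have "rcosets\<^bsub>aut_group P\<^esub> rotations = {rotations}"
      using subgroup.rcos_const[OF rotations_subgroup aut.is_group] aut.one_closed unfolding RCOSETS_def by auto
    then show False using c by simp
  qed
next
  assume r0: "rho 0 \<notin> rotations"
  let ?odd = "rotations #>\<^bsub>aut_group P\<^esub> rho 0"
  have sub: "rotations \<subseteq> Aut" using subgroup.subset[OF rotations_subgroup] .
  have odd: "rotations #>\<^bsub>aut_group P\<^esub> \<gamma> = ?odd" if "\<gamma> \<otimes>\<^bsub>aut_group P\<^esub> rho 0 \<in> rotations" "\<gamma> \<in> Aut" for \<gamma>
  proof -
    have "(\<gamma> \<otimes>\<^bsub>aut_group P\<^esub> rho 0) \<otimes>\<^bsub>aut_group P\<^esub> rho 0 = \<gamma>"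
      using that rho(1)[OF n] rho_involution[OF n] by (simp add: aut.m_assoc)
    then have "rotations #>\<^bsub>aut_group P\<^esub> \<gamma> = rotations #>\<^bsub>aut_group P\<^esub> (\<gamma> \<otimes>\<^bsub>aut_group P\<^esub> rho 0) #>\<^bsub>aut_group P\<^esub> rho 0"
      using aut.coset_mult_assoc[OF sub, of "\<gamma> \<otimes>\<^bsub>aut_group P\<^esub> rho 0" "rho 0"] that rho(1)[OF n] by simp
    then show ?thesis using subgroup.rcos_const[OF rotations_subgroup aut.is_group that(1)] by simp
  qed
  have "rcosets\<^bsub>aut_group P\<^esub> rotations = {rotations, ?odd}"
  proof (intro equalityI subsetI)
    fix C assume "C \<in> rcosets\<^bsub>aut_group P\<^esub> rotations"
    then obtain \<gamma> where "\<gamma> \<in> Aut" "C = rotations #>\<^bsub>aut_group P\<^esub> \<gamma>" unfolding RCOSETS_def by blast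
    then show "C \<in> {rotations, ?odd}"
      using rotations_or_reflected[OF n] odd subgroup.rcos_const[OF rotations_subgroup aut.is_group] by blast
  next
    fix C assume "C \<in> {rotations, ?odd}"
    then show "C \<in> rcosets\<^bsub>aut_group P\<^esub> rotations"
      using aut.coset_mult_one[OF sub] rho(1)[OF n] aut.one_closed unfolding RCOSETS_def by blast
  qed
  moreover have "rho 0 \<in> ?odd" using aut.rcos_self[OF rho(1)[OF n] rotations_subgroup] .
  then have "rotations \<noteq> ?odd" using r0 by blast
  ultimately show "card (rcosets\<^bsub>aut_group P\<^esub> rotations) = 2" by simp
qed

text \<open>
  Being a rotation is a homomorphism to a group of order 2.
\<close>

lemma rotation_parity:
  assumes n: "0 < n" and r0: "rho 0 \<notin> rotations" and \<gamma>: "\<gamma> \<in> Aut" and \<delta>: "\<delta> \<in> Aut"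
  shows "\<gamma> \<otimes>\<^bsub>aut_group P\<^esub> \<delta> \<in> rotations \<longleftrightarrow> (\<gamma> \<in> rotations \<longleftrightarrow> \<delta> \<in> rotations)"
proof -
  note closed = subgroup.m_closed[OF rotations_subgroup] subgroup.m_inv_closed[OF rotations_subgroup]
  have quot: "\<gamma> \<otimes>\<^bsub>aut_group P\<^esub> \<delta> \<in> rotations \<Longrightarrow> \<gamma> \<in> rotations \<Longrightarrow> \<delta> \<in> rotations"
    using closed \<gamma> \<delta> by (metis aut.inv_solve_left aut.m_closed)
  have quot': "\<gamma> \<otimes>\<^bsub>aut_group P\<^esub> \<delta> \<in> rotations \<Longrightarrow> \<delta> \<in> rotations \<Longrightarrow> \<gamma> \<in> rotations"
    using closed \<gamma> \<delta> by (metis aut.inv_solve_right aut.m_closed)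
  have "\<gamma> \<otimes>\<^bsub>aut_group P\<^esub> \<delta> \<in> rotations" if "\<gamma> \<notin> rotations" "\<delta> \<notin> rotations"
  proof -
    have "inv\<^bsub>aut_group P\<^esub> \<delta> \<notin> rotations" using that(2) closed(2) \<delta> by (metis aut.inv_inv)
    then have "inv\<^bsub>aut_group P\<^esub> \<delta> \<otimes>\<^bsub>aut_group P\<^esub> rho 0 \<in> rotations"
      using rotations_or_reflected[OF n] \<delta> by blast
    then have "inv\<^bsub>aut_group P\<^esub> (inv\<^bsub>aut_group P\<^esub> \<delta> \<otimes>\<^bsub>aut_group P\<^esub> rho 0) \<in> rotations" using closed(2) by blast
    moreover have "inv\<^bsub>aut_group P\<^esub> (inv\<^bsub>aut_group P\<^esub> \<delta> \<otimes>\<^bsub>aut_group P\<^esub> rho 0) = rho 0 \<otimes>\<^bsub>aut_group P\<^esub> \<delta>"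
      using \<delta> rho(1)[OF n] rho_involution[OF n] by (simp add: aut.inv_mult_group aut.inv_equality)
    moreover have "\<gamma> \<otimes>\<^bsub>aut_group P\<^esub> rho 0 \<in> rotations"
      using rotations_or_reflected[OF n \<gamma>] that(1) by blast
    ultimately have "(\<gamma> \<otimes>\<^bsub>aut_group P\<^esub> rho 0) \<otimes>\<^bsub>aut_group P\<^esub> (rho 0 \<otimes>\<^bsub>aut_group P\<^esub> \<delta>) \<in> rotations"
      using closed(1) by metis
    moreover have "(\<gamma> \<otimes>\<^bsub>aut_group P\<^esub> rho 0) \<otimes>\<^bsub>aut_group P\<^esub> (rho 0 \<otimes>\<^bsub>aut_group P\<^esub> \<delta>)
       = \<gamma> \<otimes>\<^bsub>aut_group P\<^esub> (rho 0 \<otimes>\<^bsub>aut_group P\<^esub> rho 0) \<otimes>\<^bsub>aut_group P\<^esub> \<delta>"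
      using \<gamma> \<delta> rho(1)[OF n] by (simp add: aut.m_assoc)
    ultimately show ?thesis using rho_involution[OF n] \<gamma> \<delta> by simp
  qed
  then show ?thesis using quot quot' closed(1) by blast
qed

lemma rho_not_rotation:
  assumes r0: "rho 0 \<notin> rotations" and i: "i < n"
  shows "rho i \<notin> rotations"
proof -
  have n: "0 < n" using i by simp
  show ?thesis using rotation_parity[OF n r0 rho(1)[OF i] rho(1)[OF n]] rho_rho_0[OF i] r0 by blast
qed

text \<open>
  By connectivity an automorphism either preserves the colour of every flag or reverses the colour of
  every flag. Each \<open>\<rho>\<^sub>i\<close> reverses colours, so the products \<open>\<sigma>\<^sub>i\<close> and with them all rotations preserve them.
\<close>

lemma bipartite_imp_rho_not_rotation:
  assumes n: "0 < n"
    and col: "\<And>X i. flag P X \<Longrightarrow> i < n \<Longrightarrow> col (adjacent_flag P i X) \<longleftrightarrow> \<not> col X"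
  shows "rho 0 \<notin> rotations"
proof -
  have all: "col (\<gamma> ` X) = col X \<longleftrightarrow> col (\<gamma> ` \<Phi>) = col \<Phi>" if \<gamma>: "\<gamma> \<in> Aut" and X: "flag P X" for \<gamma> X
    using base_flag X
  proof (induction rule: flag_induct)
    case (step X i)
    then show ?case using aut_adjacent_flag[OF \<gamma>, of X i] col[of X i] col[of "\<gamma> ` X" i] aut_flag[OF \<gamma>, of X] by simp
  qed simp
  have mult: "col ((\<gamma> \<otimes>\<^bsub>aut_group P\<^esub> \<delta>) ` \<Phi>) = col \<Phi> \<longleftrightarrow> (col (\<gamma> ` \<Phi>) = col \<Phi> \<longleftrightarrow> col (\<delta> ` \<Phi>) = col \<Phi>)"
    if "\<gamma> \<in> Aut" "\<delta> \<in> Aut" for \<gamma> \<delta>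
    using all[OF that(1) aut_flag[OF that(2) base_flag]]
      aut_mult_image[OF that flag_subset[OF base_flag]] by auto
  have one: "col (\<one>\<^bsub>aut_group P\<^esub> ` \<Phi>) = col \<Phi>" using aut_one_image[OF flag_subset[OF base_flag]] by simp
  have odd: "col (rho i ` \<Phi>) \<noteq> col \<Phi>" if "i < n" for i
    using rho(2)[OF that] col[OF base_flag that] by simp
  have "subgroup {\<gamma> \<in> Aut. col (\<gamma> ` \<Phi>) = col \<Phi>} (aut_group P)"
  proof (rule aut.subgroupI)
    fix \<gamma> assume "\<gamma> \<in> {\<gamma> \<in> Aut. col (\<gamma> ` \<Phi>) = col \<Phi>}"
    then show "inv\<^bsub>aut_group P\<^esub> \<gamma> \<in> {\<gamma> \<in> Aut. col (\<gamma> ` \<Phi>) = col \<Phi>}"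
      using mult[of "inv\<^bsub>aut_group P\<^esub> \<gamma>" \<gamma>] one by auto
  qed (use one mult aut.one_closed in auto)
  moreover have "\<sigma> P \<Phi> i \<in> {\<gamma> \<in> Aut. col (\<gamma> ` \<Phi>) = col \<Phi>}" if "i \<in> {1..n - 1}" for i
  proof -
    have i: "i - 1 < n" "i < n" using that by auto
    show ?thesis
      using mult[OF rho(1)[OF i(1)] rho(1)[OF i(2)]] odd[OF i(1)] odd[OF i(2)] rho(1) i
      by (simp add: \<sigma>_def)
  qed
  then have "\<sigma> P \<Phi> ` {1..n - 1} \<subseteq> {\<gamma> \<in> Aut. col (\<gamma> ` \<Phi>) = col \<Phi>}" by blast
  ultimately have "rotations \<subseteq> {\<gamma> \<in> Aut. col (\<gamma> ` \<Phi>) = col \<Phi>}"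
    unfolding rotations_eq by (rule aut.generate_subgroup_incl[rotated])
  then show ?thesis using odd[OF n] by blast
qed

end

section \<open>The coset geometry of an oriented string C-group of rank 3\<close>

text \<open>
  A string C-group of rank 3 is a group generated by three involutions \<open>r\<^sub>0, r\<^sub>1, r\<^sub>2\<close> with
  \<open>r\<^sub>0 r\<^sub>2 = r\<^sub>2 r\<^sub>0\<close> that satisfies the intersection property; it is taken here as a subgroup of an
  ambient group \<open>A\<close>. The predicate \<open>ev\<close> is the parity of words in the generators.
\<close>

locale oriented_string_C_group_3 = group A for A (structure) +
  fixes r :: "nat \<Rightarrow> 'a" and ev :: "'a \<Rightarrow> bool"
  assumes r_closed: "i < 3 \<Longrightarrow> r i \<in> carrier A"
    and r_involution: "i < 3 \<Longrightarrow> r i \<otimes> r i = \<one>"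
    and r_commute: "r 0 \<otimes> r 2 = r 2 \<otimes> r 0"
    and ev_mult: "\<lbrakk>x \<in> generate A (r ` {..<3}); y \<in> generate A (r ` {..<3})\<rbrakk>
      \<Longrightarrow> ev (x \<otimes> y) \<longleftrightarrow> (ev x \<longleftrightarrow> ev y)"
    and r_odd: "i < 3 \<Longrightarrow> \<not> ev (r i)"
    and intersection_property: "\<lbrakk>I \<subseteq> {..<3}; J \<subseteq> {..<3}\<rbrakk>
      \<Longrightarrow> generate A (r ` I) \<inter> generate A (r ` J) \<subseteq> generate A (r ` (I \<inter> J))"
begin

definition H :: "nat set \<Rightarrow> 'a set" where "H I = generate A (r ` I)"

abbreviation G :: "'a set" where "G \<equiv> H {..<3}"

definition stab :: "nat \<Rightarrow> 'a set" where "stab j = H ({..<3} - {j})"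

text \<open>
  The index \<open>x\<close> runs through all of \<open>G\<close>, but the face consists of even elements only: it is the coset
  \<open>stab j \<cdot> x\<close> of the full group cut down to the even subgroup. All of \<open>G\<close> is thereby available to
  describe flags, while the faces are literally those of the mix.
\<close>

definition face :: "nat \<Rightarrow> 'a \<Rightarrow> 'a mix_face"
  where "face j x = Coset_Face j {y \<in> G. ev y \<and> y \<otimes> inv x \<in> stab j}"

definition geometry :: "'a mix_face ranked_poset"
  where "geometry =
    \<lparr>carrier = {Least_Face, Greatest_Face} \<union> {face j x | j x. j < 3 \<and> x \<in> G},
     eq = (=), le = mix_face_le, face_rank = mix_face_rank 3\<rparr>"

definition std_flag :: "'a \<Rightarrow> 'a mix_face set"
  where "std_flag x = {Least_Face, Greatest_Face} \<union> (\<lambda>j. face j x) ` {..<3}"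

lemma H_subgroup: "I \<subseteq> {..<3} \<Longrightarrow> subgroup (H I) A"
  unfolding H_def using r_closed by (intro generate_is_subgroup) auto

lemma H_mono: "I \<subseteq> J \<Longrightarrow> H I \<subseteq> H J"
  unfolding H_def by (intro mono_generate image_mono)

lemma r_in_H: "i \<in> I \<Longrightarrow> r i \<in> H I"
  unfolding H_def by (intro generate.incl imageI)

lemma G_subgroup: "subgroup G A" by (rule H_subgroup) simp

lemma stab_subgroup: "subgroup (stab j) A" unfolding stab_def by (rule H_subgroup) auto

lemma stab_subset: "stab j \<subseteq> G" unfolding stab_def by (rule H_mono) auto

lemma G_carrier: "x \<in> G \<Longrightarrow> x \<in> carrier A"
  using subgroup.subset[OF G_subgroup] by blast

lemma G_mult: "x \<in> G \<Longrightarrow> y \<in> G \<Longrightarrow> x \<otimes> y \<in> G"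
  by (rule subgroup.m_closed[OF G_subgroup])

lemma G_inv: "x \<in> G \<Longrightarrow> inv x \<in> G"
  by (rule subgroup.m_inv_closed[OF G_subgroup])

lemma G_one: "\<one> \<in> G"
  by (rule subgroup.one_closed[OF G_subgroup])

lemma r_G: "i < 3 \<Longrightarrow> r i \<in> G"
  by (rule r_in_H) simp

lemma r_stab: "i < 3 \<Longrightarrow> i \<noteq> j \<Longrightarrow> r i \<in> stab j"
  unfolding stab_def by (rule r_in_H) simp

lemma ev_one: "ev \<one>"
  using ev_mult[of \<one> \<one>] G_one unfolding H_def by simp

lemma ev_r: "i < 3 \<Longrightarrow> x \<in> G \<Longrightarrow> ev (r i \<otimes> x) \<longleftrightarrow> \<not> ev x"
  using ev_mult[of "r i" x] r_odd r_G unfolding H_def by simp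

lemma H_induct [consumes 2, case_names one step]:
  assumes "h \<in> H I" and I: "I \<subseteq> {..<3}" and "Q \<one>"
    and "\<And>x i. x \<in> H I \<Longrightarrow> Q x \<Longrightarrow> i \<in> I \<Longrightarrow> Q (x \<otimes> r i)"
  shows "Q h"
  using assms(1) unfolding H_def
proof (rule generate_involutions_induct)
  show "r ` I \<subseteq> carrier A" using I r_closed by auto
qed (use assms r_involution in \<open>auto simp: H_def\<close>)

lemma H_empty: "H {} = {\<one>}"
  unfolding H_def using generate_empty by simp

lemma H_singleton:
  assumes i: "i < 3" and h: "h \<in> H {i}"
  shows "h = \<one> \<or> h = r i"
proof -
  have "{i} \<subseteq> {..<3}" using i by simp
  with h show ?thesis
  proof (induction rule: H_induct)
    case (step x k)
    then show ?case using r_closed[OF i] r_involution[OF i] by auto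
  qed simp
qed

lemma H_Int:
  assumes "I \<subseteq> {..<3}" "J \<subseteq> {..<3}" "h \<in> H I" "h \<in> H J"
  shows "h \<in> H (I \<inter> J)"
  using intersection_property[OF assms(1,2)] assms(3,4) unfolding H_def by blast

text \<open>
  The intersection property for two index sets yields the one for arbitrary families of vertex, edge and
  facet stabilisers.
\<close>

lemma stab_Inter:
  assumes h: "h \<in> G" and stab: "\<And>j. j \<in> J \<Longrightarrow> h \<in> stab j" and J: "J \<subseteq> {..<3}"
  shows "h \<in> H ({..<3} - J)"
proof -
  have "finite J" using J finite_subset by blast
  then show ?thesis
    using stab J
  proof (induction J)
    case empty
    then show ?case using h by simp
  next
    case (insert j J)
    then have "h \<in> H (({..<3} - J) \<inter> ({..<3} - {j}))"
      by (intro H_Int) (auto simp: stab_def)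
    moreover have "({..<3} - J) \<inter> ({..<3} - {j}) = {..<3} - insert j J" by auto
    ultimately show ?case by metis
  qed
qed

text \<open>
  Otherwise \<open>r\<^sub>j\<close> would lie in the subgroup generated by the empty set, and \<open>r\<^sub>j\<close> is odd.
\<close>

lemma r_notin_stab:
  assumes j: "j < 3" shows "r j \<notin> stab j"
proof
  assume "r j \<in> stab j"
  then have "r j \<in> H ({j} \<inter> ({..<3} - {j}))"
    using j r_in_H[of j "{j}"] by (intro H_Int) (auto simp: stab_def)
  then have "r j = \<one>" using H_empty by simp
  then show False using r_odd[OF j] ev_one by simp
qed

lemma H_02:
  assumes "h \<in> H {0, 2}"
  obtains a b where "a \<in> H {0}" "b \<in> H {2}" "h = b \<otimes> a"
proof -
  have c: "r 0 \<in> carrier A" "r 2 \<in> carrier A" by (simp_all add: r_closed)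
  have inv0: "r 0 \<otimes> r 0 = \<one>" and inv2: "r 2 \<otimes> r 2 = \<one>" by (simp_all add: r_involution)
  have "r 2 \<otimes> r 0 \<otimes> r 0 = r 2" using c inv0 by (simp add: m_assoc)
  moreover have "r 2 \<otimes> r 0 \<otimes> r 2 = r 2 \<otimes> r 2 \<otimes> r 0"
    using c by (simp only: m_assoc r_commute)
  then have "r 2 \<otimes> r 0 \<otimes> r 2 = r 0" using c inv2 by simp
  moreover have "{0, 2} \<subseteq> {..<3 :: nat}" by simp
  with assms have "h \<in> {\<one>, r 0, r 2, r 2 \<otimes> r 0}"
  proof (induction rule: H_induct)
    case (step x i)
    then have "i = 0 \<or> i = 2" and "x = \<one> \<or> x = r 0 \<or> x = r 2 \<or> x = r 2 \<otimes> r 0" by auto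
    then show ?case using c inv0 inv2 r_commute calculation by (elim disjE) simp_all
  qed simp
  moreover have "\<one> \<in> H {0}" "\<one> \<in> H {2}" by (auto simp: H_def generate.one)
  ultimately show thesis
    using that[of \<one> \<one>] that[of "r 0" \<one>] that[of \<one> "r 2"] that[of "r 0" "r 2"] c
      r_in_H[of 0 "{0}"] r_in_H[of 2 "{2}"] by auto
qed

subsection \<open>Faces and incidence\<close>

lemma face_eqI:
  assumes x: "x \<in> G" and y: "y \<in> G" and xy: "x \<otimes> inv y \<in> stab j"
  shows "face j x = face j y"
proof -
  note c = G_carrier[OF x] G_carrier[OF y]
  have yx: "y \<otimes> inv x \<in> stab j"
    using subgroup.m_inv_closed[OF stab_subgroup xy] c by (simp add: inv_mult_group)
  have "z \<otimes> inv x \<in> stab j \<longleftrightarrow> z \<otimes> inv y \<in> stab j" if z: "z \<in> G" for z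
  proof -
    have "z \<otimes> inv x \<otimes> (x \<otimes> inv y) = z \<otimes> (inv x \<otimes> x) \<otimes> inv y"
      using c G_carrier[OF z] by (simp only: m_assoc m_closed inv_closed)
    moreover have "z \<otimes> inv y \<otimes> (y \<otimes> inv x) = z \<otimes> (inv y \<otimes> y) \<otimes> inv x"
      using c G_carrier[OF z] by (simp only: m_assoc m_closed inv_closed)
    ultimately show ?thesis
      using subgroup.m_closed[OF stab_subgroup _ xy] subgroup.m_closed[OF stab_subgroup _ yx]
        c G_carrier[OF z] by (metis l_inv r_one)
  qed
  then show ?thesis unfolding face_def by auto
qed

lemma face_eqI_left:
  assumes "x \<in> G" "h \<in> stab j" shows "face j (h \<otimes> x) = face j x"
proof (rule face_eqI)
  show "h \<otimes> x \<in> G" using assms stab_subset G_mult by blast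
  have "h \<in> carrier A" using assms(2) stab_subset G_carrier by blast
  then show "h \<otimes> x \<otimes> inv x \<in> stab j"
    using assms G_carrier by (simp add: m_assoc)
qed (rule assms)

lemma face_r: "i < 3 \<Longrightarrow> i \<noteq> j \<Longrightarrow> x \<in> G \<Longrightarrow> face j (r i \<otimes> x) = face j x"
  by (intro face_eqI_left r_stab)

text \<open>
  For given \<open>i\<close> and \<open>j\<close> some generator \<open>r\<^sub>k\<close> differs from both \<open>r\<^sub>i\<close> and \<open>r\<^sub>j\<close>. Multiplication by \<open>r\<^sub>k\<close>
  changes the parity of \<open>x\<close> and keeps its \<open>i\<close>-face and its \<open>j\<close>-face.
\<close>

lemma even_representative:
  assumes "x \<in> G"
  obtains z where "z \<in> G" "ev z" "face i z = face i x" "face j z = face j x"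
proof -
  obtain k :: nat where k: "k < 3" "k \<noteq> i" "k \<noteq> j"
  proof -
    have "\<exists>k \<in> {0, 1, 2 :: nat}. k \<noteq> i \<and> k \<noteq> j" by auto
    then obtain k :: nat where "k \<in> {0, 1, 2}" "k \<noteq> i" "k \<noteq> j" by blast
    then show thesis using that[of k] by auto
  qed
  show thesis
  proof (cases "ev x")
    case True
    then show thesis using that assms by blast
  next
    case False
    then show thesis using that[of "r k \<otimes> x"] assms k face_r ev_r r_G G_mult by simp
  qed
qed

lemma face_eq_imp:
  assumes x: "x \<in> G" and y: "y \<in> G" and eq: "face j x = face j y"
  shows "x \<otimes> inv y \<in> stab j"
proof -
  obtain z where z: "z \<in> G" "ev z" "face j z = face j x" by (rule even_representative[OF x, of j j])
  have c: "x \<in> carrier A" "y \<in> carrier A" "z \<in> carrier A" using x y z G_carrier by auto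
  have "z \<otimes> inv z \<in> stab j" using c subgroup.one_closed[OF stab_subgroup] by simp
  then have "z \<otimes> inv x \<in> stab j" "z \<otimes> inv y \<in> stab j" using z eq unfolding face_def by auto
  then have "inv (z \<otimes> inv x) \<otimes> (z \<otimes> inv y) \<in> stab j"
    using subgroup.m_closed[OF stab_subgroup] subgroup.m_inv_closed[OF stab_subgroup] by blast
  moreover have "inv (z \<otimes> inv x) \<otimes> (z \<otimes> inv y) = x \<otimes> (inv z \<otimes> z) \<otimes> inv y"
    using c by (simp only: inv_mult_group inv_inv m_assoc m_closed inv_closed)
  ultimately show ?thesis using c by simp
qed

lemma face_eq_iff:
  "x \<in> G \<Longrightarrow> y \<in> G \<Longrightarrow> face i x = face j y \<longleftrightarrow> i = j \<and> x \<otimes> inv y \<in> stab j"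
  using face_eqI face_eq_imp by (metis face_def mix_face.inject)

text \<open>
  Incidence as nonempty intersection of cosets amounts to incidence in a common flag \<open>z\<close>. From here on
  only equality of faces matters.
\<close>

lemma face_le_iff:
  assumes x: "x \<in> G" and y: "y \<in> G"
  shows "mix_face_le (face i x) (face j y) \<longleftrightarrow>
    face i x = face j y \<or> i < j \<and> (\<exists>z \<in> G. face i z = face i x \<and> face j z = face j y)"
proof -
  let ?X = "{z \<in> G. ev z \<and> z \<otimes> inv x \<in> stab i}" and ?Y = "{z \<in> G. ev z \<and> z \<otimes> inv y \<in> stab j}"
  have "?X \<inter> ?Y \<noteq> {} \<longleftrightarrow> (\<exists>z \<in> G. face i z = face i x \<and> face j z = face j y)"
  proof
    assume "?X \<inter> ?Y \<noteq> {}"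
    then show "\<exists>z \<in> G. face i z = face i x \<and> face j z = face j y"
      using face_eqI x y by blast
  next
    assume "\<exists>z \<in> G. face i z = face i x \<and> face j z = face j y"
    then obtain z where z: "z \<in> G" "face i z = face i x" "face j z = face j y" by blast
    obtain w where "w \<in> G" "ev w" "face i w = face i z" "face j w = face j z"
      by (rule even_representative[OF z(1)])
    then have "w \<in> ?X \<inter> ?Y" using z x y face_eq_imp by simp
    then show "?X \<inter> ?Y \<noteq> {}" by blast
  qed
  moreover have "mix_face_le (face i x) (face j y) \<longleftrightarrow> face i x = face j y \<or> i < j \<and> ?X \<inter> ?Y \<noteq> {}"
    unfolding mix_face_le_def by (auto simp: face_def)
  ultimately show ?thesis by simp
qed

lemma face_neq [simp]:
  "face j x \<noteq> Least_Face" "face j x \<noteq> Greatest_Face" "Least_Face \<noteq> face j x" "Greatest_Face \<noteq> face j x"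
  by (auto simp: face_def)

lemma face_index: "face i x = face j y \<Longrightarrow> i = j"
  by (simp add: face_def)

lemma mix_face_rank_face [simp]: "mix_face_rank n (face j x) = int j"
  by (simp add: face_def)

lemma Least_le [simp]: "mix_face_le Least_Face F" "mix_face_le F Greatest_Face"
  by (auto simp: mix_face_le_def)

lemma le_Least_iff [simp]: "mix_face_le F Least_Face \<longleftrightarrow> F = Least_Face"
  "mix_face_le Greatest_Face F \<longleftrightarrow> F = Greatest_Face"
  by (auto simp: mix_face_le_def)

text \<open>
  Two flags with a common edge differ by an element of \<open>{1, r\<^sub>0, r\<^sub>2, r\<^sub>0 r\<^sub>2}\<close>, so the vertex of one and
  the 2-face of the other can be combined in one flag. Both the transitivity of incidence and the
  extension of chains to flags rest on this.
\<close>

lemma merge_at_edge: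
  assumes x: "x \<in> G" and y: "y \<in> G" and eq: "face 1 x = face 1 y"
  obtains z where "z \<in> G" "face 0 z = face 0 x" "face 1 z = face 1 x" "face 2 z = face 2 y"
proof -
  have "{..<3} - {1} = {0, 2 :: nat}" by auto
  then have "x \<otimes> inv y \<in> H {0, 2}" using face_eq_imp[OF x y eq] by (simp add: stab_def)
  then obtain a b where ab: "a \<in> H {0}" "b \<in> H {2}" "x \<otimes> inv y = b \<otimes> a" by (rule H_02)
  have a: "a \<in> stab 1" "a \<in> stab 2" and b: "b \<in> stab 0"
    using ab(1,2) H_mono[of "{0}" "{..<3} - {1}"] H_mono[of "{0}" "{..<3} - {2}"]
      H_mono[of "{2}" "{..<3} - {0}"] by (auto simp: stab_def)
  have c: "x \<in> carrier A" "y \<in> carrier A" "a \<in> carrier A" "b \<in> carrier A"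
    using x y a b stab_subset G_carrier by blast+
  have xe: "x = b \<otimes> (a \<otimes> y)"
    using ab(3) c by (metis inv_solve_right m_assoc m_closed)
  have ay: "a \<otimes> y \<in> G" using a(1) y stab_subset G_mult by blast
  show thesis
  proof (rule that[OF ay])
    show "face 0 (a \<otimes> y) = face 0 x" using face_eqI_left[OF ay b] xe by simp
    show "face 1 (a \<otimes> y) = face 1 x" using face_eqI_left[OF y a(1)] eq by simp
    show "face 2 (a \<otimes> y) = face 2 y" using face_eqI_left[OF y a(2)] .
  qed
qed

lemma less_3_cases: "j < 3 \<Longrightarrow> (j = 0 \<Longrightarrow> R) \<Longrightarrow> (j = 1 \<Longrightarrow> R) \<Longrightarrow> (j = 2 \<Longrightarrow> R) \<Longrightarrow> R" for j :: nat
  by linarith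

lemma geometry_simps [simp]:
  "le geometry = mix_face_le" "eq geometry = (=)" "face_rank geometry = mix_face_rank 3"
  by (simp_all add: geometry_def)

lemma carrier_geometry: "F \<in> carrier geometry \<longleftrightarrow>
  F = Least_Face \<or> F = Greatest_Face \<or> (\<exists>j x. j < 3 \<and> x \<in> G \<and> F = face j x)"
  by (auto simp: geometry_def)

lemma face_in_carrier: "j < 3 \<Longrightarrow> x \<in> G \<Longrightarrow> face j x \<in> carrier geometry"
  unfolding carrier_geometry by blast

lemma geometry_partial_order: "partial_order geometry"
proof
  fix F F' F''
  assume le: "F \<sqsubseteq>\<^bsub>geometry\<^esub> F'" "F' \<sqsubseteq>\<^bsub>geometry\<^esub> F''"
    and c: "F \<in> carrier geometry" "F' \<in> carrier geometry" "F'' \<in> carrier geometry"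
  show "F \<sqsubseteq>\<^bsub>geometry\<^esub> F''"
  proof (cases "F = F' \<or> F' = F'' \<or> F = Least_Face \<or> F'' = Greatest_Face")
    case True
    then show ?thesis using le by auto
  next
    case False
    then obtain i x j y k z where f: "i < 3" "x \<in> G" "F = face i x" "j < 3" "y \<in> G" "F' = face j y"
        "k < 3" "z \<in> G" "F'' = face k z"
      using c le unfolding carrier_geometry by auto
    obtain u where u: "i < j" "u \<in> G" "face i u = face i x" "face j u = face j y"
      using le(1) False f face_le_iff by auto
    obtain v where v: "j < k" "v \<in> G" "face j v = face j y" "face k v = face k z"
      using le(2) False f face_le_iff by auto
    have ijk: "i = 0" "j = 1" "k = 2" using u(1) v(1) f(7) by auto
    obtain w where "w \<in> G" "face 0 w = face 0 u" "face 2 w = face 2 v"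
      using merge_at_edge[OF u(2) v(2)] u v unfolding ijk by metis
    then have "\<exists>w \<in> G. face i w = face i x \<and> face k w = face k z" using u v unfolding ijk by auto
    then show ?thesis using face_le_iff[OF f(2,8), of i k] f ijk by simp
  qed
next
  fix F F' assume le: "F \<sqsubseteq>\<^bsub>geometry\<^esub> F'" "F' \<sqsubseteq>\<^bsub>geometry\<^esub> F"
  show "F .=\<^bsub>geometry\<^esub> F'" using le by (auto simp: mix_face_le_def)
qed (auto simp: mix_face_le_def)

text \<open>
  If the chain contains an edge, its vertex and its 2-face each share a flag with that edge, and the two
  flags are merged at the edge. A chain without an edge has at most two proper faces, and these share a
  flag by the definition of incidence.
\<close>

lemma chain_in_std_flag:
  assumes C: "pred_on.chain (carrier geometry) (le geometry) C"
  obtains x where "x \<in> G" "C \<subseteq> std_flag x"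
proof -
  have comparable: "F = F' \<or> mix_face_le F F' \<or> mix_face_le F' F" if "F \<in> C" "F' \<in> C" for F F'
    using C that unfolding pred_on.chain_def by auto
  have same: "face j x = face j y" if "face j x \<in> C" "face j y \<in> C" "x \<in> G" "y \<in> G" for j x y
    using comparable[OF that(1,2)] face_le_iff that(3,4) by auto
  have incident: "\<exists>z \<in> G. face i z = face i x \<and> face j z = face j y"
    if "face i x \<in> C" "face j y \<in> C" "x \<in> G" "y \<in> G" "i < j" for i j x y
  proof -
    have "face i x \<noteq> face j y" using that(5) by (auto simp: face_def)
    then show ?thesis using comparable[OF that(1,2)] that(3-5) face_le_iff by auto
  qed
  \<comment> \<open>\<open>agrees j x\<close> also holds if the chain has no face of rank \<open>j\<close>.\<close>
  define agrees where "agrees j x \<longleftrightarrow> (\<forall>y \<in> G. face j y \<in> C \<longrightarrow> face j y = face j x)" for j x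
  have extend: "\<exists>z \<in> G. face i z = face i x \<and> agrees j z"
    if u: "face i x \<in> C" "x \<in> G" "i \<noteq> j" for i j x
  proof (cases "\<exists>y \<in> G. face j y \<in> C")
    case True
    then obtain y where y: "y \<in> G" "face j y \<in> C" by blast
    then obtain z where "z \<in> G" "face i z = face i x" "face j z = face j y"
      using incident[OF u(1) y(2) u(2) y(1)] incident[OF y(2) u(1) y(1) u(2)] u(3)
      by (metis linorder_neqE_nat)
    then show ?thesis using same y unfolding agrees_def by metis
  next
    case False
    then show ?thesis using u unfolding agrees_def by blast
  qed
  have "\<exists>x \<in> G. agrees 0 x \<and> agrees 1 x \<and> agrees 2 x"
  proof (cases "\<exists>u \<in> G. face 1 u \<in> C")
    case True
    then obtain u where u: "u \<in> G" "face 1 u \<in> C" by blast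
    obtain a where a: "a \<in> G" "face 1 a = face 1 u" "agrees 0 a" using extend[OF u(2,1), of 0] by auto
    obtain b where b: "b \<in> G" "face 1 b = face 1 u" "agrees 2 b" using extend[OF u(2,1), of 2] by auto
    obtain z where "z \<in> G" "face 0 z = face 0 a" "face 1 z = face 1 a" "face 2 z = face 2 b"
      by (rule merge_at_edge[OF a(1) b(1)]) (use a b in auto)
    moreover have "agrees 1 u" using same u unfolding agrees_def by blast
    ultimately show ?thesis using a b unfolding agrees_def by metis
  next
    case no1: False
    then have 1: "agrees 1 x" for x unfolding agrees_def by blast
    show ?thesis
    proof (cases "\<exists>u \<in> G. face 0 u \<in> C")
      case True
      then obtain u where u: "u \<in> G" "face 0 u \<in> C" by blast
      then obtain a where "a \<in> G" "face 0 a = face 0 u" "agrees 2 a" using extend[OF u(2,1), of 2] by auto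
      moreover have "agrees 0 u" using same u unfolding agrees_def by blast
      ultimately show ?thesis using 1 unfolding agrees_def by metis
    next
      case no0: False
      then have 0: "agrees 0 x" for x unfolding agrees_def by blast
      show ?thesis
      proof (cases "\<exists>u \<in> G. face 2 u \<in> C")
        case True
        then obtain u where u: "u \<in> G" "face 2 u \<in> C" by blast
        then have "agrees 2 u" using same unfolding agrees_def by blast
        then show ?thesis using 0 1 u by blast
      next
        case False
        then show ?thesis using 0 1 G_one unfolding agrees_def by blast
      qed
    qed
  qed
  then obtain x where x: "x \<in> G" and ag: "agrees 0 x" "agrees 1 x" "agrees 2 x" by blast
  have "C \<subseteq> std_flag x"
  proof
    fix F assume F: "F \<in> C"
    then have "F \<in> carrier geometry" using C unfolding pred_on.chain_def by blast
    then consider "F = Least_Face" | "F = Greatest_Face" | j y where "j < 3" "y \<in> G" "F = face j y"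
      unfolding carrier_geometry by blast
    then show "F \<in> std_flag x"
    proof cases
      case 3
      then have "face j y = face j x"
        using ag F unfolding agrees_def by (elim less_3_cases) auto
      then show ?thesis using 3 unfolding std_flag_def by auto
    qed (auto simp: std_flag_def)
  qed
  then show thesis using that x by blast
qed

lemma std_flag_le:
  assumes x: "x \<in> G" and F: "F \<in> std_flag x" "F' \<in> std_flag x"
    and le: "mix_face_rank 3 F \<le> mix_face_rank 3 F'"
  shows "mix_face_le F F'"
proof -
  consider "F = Least_Face" | "F = Greatest_Face" | j where "j < 3" "F = face j x"
    using F(1) unfolding std_flag_def by auto
  then show ?thesis
  proof cases
    case 1
    then show ?thesis by simp
  next
    case 2
    then show ?thesis using le F(2) unfolding std_flag_def by auto
  next
    case 3
    then consider "F' = Greatest_Face" | k where "k < 3" "F' = face k x" "j \<le> k"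
      using le F(2) unfolding std_flag_def by auto
    then show ?thesis using 3 face_le_iff[OF x x] x by cases (auto simp: le_less)
  qed
qed

lemma std_flag_rank_inj:
  assumes "F \<in> std_flag x" "F' \<in> std_flag x" "mix_face_rank 3 F = mix_face_rank 3 F'"
  shows "F = F'"
  using assms unfolding std_flag_def by auto

lemma face_in_std_flag_iff:
  "j < 3 \<Longrightarrow> face j y \<in> std_flag x \<longleftrightarrow> face j y = face j x"
  unfolding std_flag_def by (auto simp: face_def)

lemma std_flag_chain:
  assumes x: "x \<in> G" shows "pred_on.chain (carrier geometry) (le geometry) (std_flag x)"
  unfolding pred_on.chain_def
proof (intro conjI ballI)
  show "std_flag x \<subseteq> carrier geometry" using x face_in_carrier unfolding std_flag_def by (auto simp: geometry_def)
  fix F F' assume F: "F \<in> std_flag x" "F' \<in> std_flag x"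
  show "(le geometry)\<^sup>=\<^sup>= F F' \<or> (le geometry)\<^sup>=\<^sup>= F' F"
    using std_flag_le[OF x F] std_flag_le[OF x F(2,1)] by (metis geometry_simps(1) linear sup2I1)
qed

lemma std_flag_eqI: "(\<And>j. j < 3 \<Longrightarrow> face j x = face j y) \<Longrightarrow> std_flag x = std_flag y"
  unfolding std_flag_def by auto

lemma std_flag_subset_eq: "std_flag x \<subseteq> std_flag y \<Longrightarrow> std_flag x = std_flag y"
  by (rule std_flag_eqI) (auto simp: std_flag_def face_def)

lemma flag_geometry_iff: "flag geometry X \<longleftrightarrow> (\<exists>x \<in> G. X = std_flag x)"
proof
  assume X: "flag geometry X"
  then have "pred_on.chain (carrier geometry) (le geometry) X"
    unfolding flag_def pred_on.maxchain_def by simp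
  then obtain x where "x \<in> G" "X \<subseteq> std_flag x" by (rule chain_in_std_flag)
  then show "\<exists>x \<in> G. X = std_flag x"
    using X std_flag_chain unfolding flag_def pred_on.maxchain_def by (metis psubsetI)
next
  assume "\<exists>x \<in> G. X = std_flag x"
  then obtain x where x: "x \<in> G" "X = std_flag x" by blast
  show "flag geometry X"
    unfolding flag_def pred_on.maxchain_def
  proof (intro conjI notI)
    show "pred_on.chain (carrier geometry) (le geometry) X" using std_flag_chain x by simp
    assume "\<exists>S. pred_on.chain (carrier geometry) (le geometry) S \<and> X \<subset> S"
    then obtain S y where "X \<subset> S" "S \<subseteq> std_flag y" using chain_in_std_flag by metis
    then show False using std_flag_subset_eq[of x y] x by blast
  qed
qed

text \<open>
  Two group elements with the same flag differ by an element of the intersection of all three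
  stabilisers, which is trivial.
\<close>

lemma std_flag_inj:
  assumes x: "x \<in> G" and y: "y \<in> G" and eq: "std_flag x = std_flag y"
  shows "x = y"
proof -
  have "x \<otimes> inv y \<in> stab j" if "j \<in> {..<3}" for j
    using face_eq_imp[OF x y] face_in_std_flag_iff[of j x x] face_in_std_flag_iff[of j x y] eq that
    by simp
  then have "x \<otimes> inv y \<in> H ({..<3} - {..<3})"
    by (intro stab_Inter) (use x y G_mult G_inv in auto)
  then have "x \<otimes> inv y = \<one>" using H_empty by simp
  then show ?thesis using G_carrier[OF x] G_carrier[OF y] by (metis inv_closed inv_equality inv_inv)
qed

lemma std_flag_r:
  assumes x: "x \<in> G" and i: "i < 3"
  shows "face i (r i \<otimes> x) \<noteq> face i x"
    and "std_flag x - std_flag (r i \<otimes> x) = {face i x}"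
    and "std_flag (r i \<otimes> x) - std_flag x = {face i (r i \<otimes> x)}"
proof -
  show ne: "face i (r i \<otimes> x) \<noteq> face i x"
  proof
    assume "face i (r i \<otimes> x) = face i x"
    then have "r i \<otimes> x \<otimes> inv x \<in> stab i"
      using face_eq_imp x i r_G G_mult by blast
    then show False using r_notin_stab[OF i] r_closed[OF i] G_carrier[OF x] by (simp add: m_assoc)
  qed
  have eq: "face j (r i \<otimes> x) = face j x" if "j \<noteq> i" for j using face_r[OF i _ x] that by metis
  have "std_flag y = insert (face i y) ({Least_Face, Greatest_Face} \<union> (\<lambda>j. face j y) ` ({..<3} - {i}))" for y
    using i unfolding std_flag_def by auto
  moreover have "(\<lambda>j. face j (r i \<otimes> x)) ` ({..<3} - {i}) = (\<lambda>j. face j x) ` ({..<3} - {i})"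
    using eq by (intro image_cong) auto
  moreover have "face i y \<notin> {Least_Face, Greatest_Face} \<union> (\<lambda>j. face j x) ` ({..<3} - {i})" for y
    by (auto simp: face_def)
  ultimately show "std_flag x - std_flag (r i \<otimes> x) = {face i x}"
    "std_flag (r i \<otimes> x) - std_flag x = {face i (r i \<otimes> x)}"
    using ne by (auto dest: face_index)
qed


subsection \<open>The geometry is a regular polyhedron\<close>

lemma std_flag_carrier: "x \<in> G \<Longrightarrow> std_flag x \<subseteq> carrier geometry"
  using std_flag_chain unfolding pred_on.chain_def by blast

text \<open>
  If \<open>J\<close> is the set of ranks in which the flags of \<open>x\<close> and \<open>y\<close> agree, the intersection property writes
  \<open>y x\<^sup>-\<^sup>1\<close> as a word in the \<open>r\<^sub>i\<close> with \<open>i \<notin> J\<close>. The word spells a sequence of adjacent flags in which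
  the faces of ranks in \<open>J\<close> never change.
\<close>

lemma std_flag_connected:
  assumes x: "x \<in> G" and y: "y \<in> G"
  shows "(\<lambda>X Y. flag geometry X \<and> flag geometry Y \<and> adjacent X Y
    \<and> std_flag x \<inter> std_flag y \<subseteq> X \<and> std_flag x \<inter> std_flag y \<subseteq> Y)\<^sup>*\<^sup>* (std_flag x) (std_flag y)"
    (is "?R\<^sup>*\<^sup>* _ _")
proof -
  define J where "J = {j. j < 3 \<and> face j x = face j y}"
  define I where "I = {..<3} - J"
  have yx: "y \<otimes> inv x \<in> G" using x y G_mult G_inv by blast
  have "y \<otimes> inv x \<in> H I"
    unfolding I_def
  proof (rule stab_Inter[OF yx])
    fix j assume "j \<in> J"
    then show "y \<otimes> inv x \<in> stab j" using face_eq_imp[OF y x] unfolding J_def by simp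
  qed (auto simp: J_def)
  have common: "std_flag x \<inter> std_flag y \<subseteq> std_flag z" if z: "\<And>j. j \<in> J \<Longrightarrow> face j z = face j x" for z
  proof
    fix F assume F: "F \<in> std_flag x \<inter> std_flag y"
    then consider "F = Least_Face" | "F = Greatest_Face" | j where "j < 3" "F = face j x"
      unfolding std_flag_def by auto
    then show "F \<in> std_flag z"
    proof cases
      case 3
      then have "j \<in> J" using F face_in_std_flag_iff[of j x y] unfolding J_def by simp
      then show ?thesis using 3 z face_in_std_flag_iff[of j x z] by simp
    qed (auto simp: std_flag_def)
  qed
  have I: "I \<subseteq> {..<3}" unfolding I_def by blast
  have edge: "?R (std_flag z) (std_flag (r i \<otimes> z))"
    if z: "z \<in> G" "\<And>j. j \<in> J \<Longrightarrow> face j z = face j x" and i: "i \<in> I" for z i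
  proof -
    have i3: "i < 3" and iJ: "i \<notin> J" using i unfolding I_def by auto
    have "face j (r i \<otimes> z) = face j x" if "j \<in> J" for j
      using z(2)[OF that] face_r[OF i3 _ z(1), of j] iJ that by metis
    then show ?thesis
      using common z std_flag_r[OF z(1) i3] r_G[OF i3] G_mult
      unfolding flag_geometry_iff adjacent_def by auto
  qed
  have "\<forall>z \<in> G. (\<forall>j \<in> J. face j z = face j x) \<longrightarrow> ?R\<^sup>*\<^sup>* (std_flag z) (std_flag (y \<otimes> inv x \<otimes> z))"
    using \<open>y \<otimes> inv x \<in> H I\<close> I
  proof (induction rule: H_induct)
    case one
    then show ?case using G_carrier by simp
  next
    case (step w i)
    have w: "w \<in> carrier A" using step(1) H_mono[OF I] G_carrier by blast
    have i: "i < 3" "i \<notin> J" using step(2) unfolding I_def by auto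
    show ?case
    proof (intro ballI impI)
      fix z assume z: "z \<in> G" "\<forall>j \<in> J. face j z = face j x"
      have rz: "r i \<otimes> z \<in> G" using G_mult[OF r_G[OF i(1)] z(1)] .
      have "\<forall>j \<in> J. face j (r i \<otimes> z) = face j x"
        using z face_r[OF i(1) _ z(1)] i(2) by metis
      then have "?R\<^sup>*\<^sup>* (std_flag (r i \<otimes> z)) (std_flag (w \<otimes> (r i \<otimes> z)))"
        using step(3) rz by blast
      moreover have "?R (std_flag z) (std_flag (r i \<otimes> z))"
        using edge[OF z(1) _ step(2)] z(2) by blast
      ultimately have "?R\<^sup>*\<^sup>* (std_flag z) (std_flag (w \<otimes> (r i \<otimes> z)))"
        by (rule converse_rtranclp_into_rtranclp[rotated])
      then show "?R\<^sup>*\<^sup>* (std_flag z) (std_flag (w \<otimes> r i \<otimes> z))"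
        using w r_closed[OF i(1)] G_carrier[OF z(1)] by (simp add: m_assoc)
    qed
  qed
  then have "?R\<^sup>*\<^sup>* (std_flag x) (std_flag (y \<otimes> inv x \<otimes> x))" using x by blast
  then show ?thesis using G_carrier[OF x] G_carrier[OF y] by (simp add: m_assoc)
qed

text \<open>
  Modulo the stabiliser of the \<open>j\<close>-face, an element that fixes the neighbours of the \<open>j\<close>-face in a flag is
  \<open>1\<close> or \<open>r\<^sub>j\<close>. For the edge this is the intersection property; a vertex or a 2-face has the edge as its
  only proper neighbour, and the stabiliser of the edge is the product of the subgroups generated by
  \<open>r\<^sub>0\<close> and \<open>r\<^sub>2\<close>.
\<close>

lemma residue_faces:
  assumes x: "x \<in> G" and y: "y \<in> G" and j: "j < 3"
    and eq: "\<And>k. k < 3 \<Longrightarrow> k + 1 = j \<or> k = j + 1 \<Longrightarrow> face k y = face k x"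
  shows "face j y = face j x \<or> face j y = face j (r j \<otimes> x)"
proof -
  have c: "x \<in> carrier A" "y \<in> carrier A" using x y G_carrier by auto
  have "\<exists>a \<in> H {j}. face j y = face j (a \<otimes> x)"
  proof (cases "j = 1")
    case True
    have "y \<otimes> inv x \<in> H ({..<3} - {0, 2})"
    proof (rule stab_Inter)
      fix k :: nat assume "k \<in> {0, 2}"
      then have "face k y = face k x" using eq[of k] True by auto
      then show "y \<otimes> inv x \<in> stab k" using face_eq_imp[OF y x] by blast
    qed (use x y G_mult G_inv in auto)
    moreover have "{..<3} - {0, 2} = {1 :: nat}" by auto
    moreover have "y = y \<otimes> inv x \<otimes> x" using c by (simp add: m_assoc)
    ultimately show ?thesis using True by metis
  next
    case False
    then have j02: "j = 0 \<or> j = 2" using j by auto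
    have "face 1 y = face 1 x" using eq[of 1] j02 by auto
    have "{..<3} - {1} = {0, 2 :: nat}" by auto
    then have *: "y \<otimes> inv x \<in> H {0, 2}" "x \<otimes> inv y \<in> H {0, 2}"
      using face_eq_imp[OF y x \<open>face 1 y = face 1 x\<close>] face_eq_imp[OF x y \<open>face 1 y = face 1 x\<close>[symmetric]]
      by (simp_all add: stab_def)
    show ?thesis
    proof (cases "j = 0")
      case True
      obtain a b where ab: "a \<in> H {0}" "b \<in> H {2}" "y \<otimes> inv x = b \<otimes> a" by (rule H_02[OF *(1)])
      have b: "b \<in> stab 0" using ab(2) H_mono[of "{2}" "{..<3} - {0}"] by (auto simp: stab_def)
      have a: "a \<in> G" using ab(1) H_mono[of "{0}" "{..<3}"] by auto
      have "b \<in> carrier A" using b stab_subset G_carrier by blast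
      then have "y = b \<otimes> (a \<otimes> x)"
        using ab(3) c G_carrier[OF a] by (metis inv_solve_right m_assoc m_closed)
      then show ?thesis using face_eqI_left[OF G_mult[OF a x] b] ab(1) True by auto
    next
      case False
      then have j2: "j = 2" using j02 by simp
      obtain a b where ab: "a \<in> H {0}" "b \<in> H {2}" "x \<otimes> inv y = b \<otimes> a" by (rule H_02[OF *(2)])
      have a: "a \<in> stab 2" using ab(1) H_mono[of "{0}" "{..<3} - {2}"] by (auto simp: stab_def)
      have b: "b \<in> G" using ab(2) H_mono[of "{2}" "{..<3}"] by auto
      have ac: "a \<in> carrier A" using a stab_subset G_carrier by blast
      have "x = b \<otimes> (a \<otimes> y)"
        using ab(3) c ac G_carrier[OF b] by (metis inv_solve_right m_assoc m_closed)
      \<comment> \<open>The factorisation of \<open>x y\<^sup>-\<^sup>1\<close>, not of its inverse, puts the factor \<open>a\<close> that fixes the 2-face next to \<open>y\<close>.\<close>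
      then have "inv b \<otimes> x = a \<otimes> y"
        using c ac G_carrier[OF b] by (metis inv_solve_left m_closed)
      moreover have "inv b \<in> H {2}"
        by (rule subgroup.m_inv_closed[OF H_subgroup ab(2)]) simp
      ultimately show ?thesis using face_eqI_left[OF y a] j2 by metis
    qed
  qed
  then obtain a where a: "a \<in> H {j}" "face j y = face j (a \<otimes> x)" by blast
  then show ?thesis using H_singleton[OF j a(1)] c by auto
qed

lemma lless_geometry: "F \<sqsubset>\<^bsub>geometry\<^esub> F' \<longleftrightarrow> mix_face_le F F' \<and> F \<noteq> F'"
  by (simp add: lless_def)

lemma geometry_rank_less:
  assumes "F \<in> carrier geometry" "F' \<in> carrier geometry" "mix_face_le F F'" "F \<noteq> F'"
  shows "mix_face_rank 3 F < mix_face_rank 3 F'"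
proof -
  consider "F = Least_Face" | "F = Greatest_Face" | "F' = Least_Face" | "F' = Greatest_Face"
    | i j x y where "i < 3" "j < 3" "x \<in> G" "y \<in> G" "F = face i x" "F' = face j y"
    using assms(1,2) unfolding carrier_geometry by blast
  then show ?thesis
  proof cases
    case 5
    then show ?thesis using assms(3,4) face_le_iff[OF 5(3,4)] by auto
  qed (use assms in \<open>auto simp: carrier_geometry\<close>)
qed

lemma geometry_diamond:
  assumes F: "F \<in> carrier geometry" and F': "F' \<in> carrier geometry"
    and less: "mix_face_le F F'" "F \<noteq> F'"
    and rank: "mix_face_rank 3 F = k - 1" "mix_face_rank 3 F' = k + 1"
  shows "card {E \<in> carrier geometry. mix_face_rank 3 E = k \<and>
    (mix_face_le F E \<and> F \<noteq> E) \<and> mix_face_le E F' \<and> E \<noteq> F'} = 2"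
proof -
  have between: "\<exists>x \<in> G. C \<subseteq> std_flag x"
    if "C \<subseteq> carrier geometry" "\<forall>a \<in> C. \<forall>b \<in> C. a = b \<or> mix_face_le a b \<or> mix_face_le b a" for C
  proof -
    have "pred_on.chain (carrier geometry) (le geometry) C"
      using that unfolding pred_on.chain_def by auto
    then show ?thesis using chain_in_std_flag by metis
  qed
  obtain x where x: "x \<in> G" "F \<in> std_flag x" "F' \<in> std_flag x"
    using between[of "{F, F'}"] F F' less by auto
  have "k \<in> {0, 1, 2}" using rank x(2,3) unfolding std_flag_def by auto
  then obtain j where j: "j < 3" "k = int j" by force
  let ?x = "r j \<otimes> x"
  have x': "?x \<in> G" using G_mult[OF r_G[OF j(1)] x(1)] .
  have stay: "E \<in> std_flag ?x" if E: "E \<in> std_flag x" "mix_face_rank 3 E \<noteq> int j" for E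
  proof (rule ccontr)
    assume "E \<notin> std_flag ?x"
    then have "E = face j x" using std_flag_r(2)[OF x(1) j(1)] E(1) by blast
    then show False using E(2) by simp
  qed
  have "F \<in> std_flag ?x" by (rule stay[OF x(2)]) (use rank j(2) in simp)
  have "F' \<in> std_flag ?x" by (rule stay[OF x(3)]) (use rank j(2) in simp)
  have mem: "face j z \<in> {E \<in> carrier geometry. mix_face_rank 3 E = k \<and>
    (mix_face_le F E \<and> F \<noteq> E) \<and> mix_face_le E F' \<and> E \<noteq> F'}"
    if z: "z \<in> G" "F \<in> std_flag z" "F' \<in> std_flag z" for z
  proof -
    have fz: "face j z \<in> std_flag z" using face_in_std_flag_iff[OF j(1)] by blast
    have "mix_face_le F (face j z)" by (rule std_flag_le[OF z(1,2) fz]) (use rank j(2) in simp)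
    moreover have "mix_face_le (face j z) F'" by (rule std_flag_le[OF z(1) fz z(3)]) (use rank j(2) in simp)
    moreover have "F \<noteq> face j z" "face j z \<noteq> F'" using rank j(2) by auto
    ultimately show ?thesis using face_in_carrier[OF j(1) z(1)] j(2) by simp
  qed
  have "{E \<in> carrier geometry. mix_face_rank 3 E = k \<and>
    (mix_face_le F E \<and> F \<noteq> E) \<and> mix_face_le E F' \<and> E \<noteq> F'} = {face j x, face j ?x}"
  proof (intro equalityI subsetI)
    fix E assume E: "E \<in> {E \<in> carrier geometry. mix_face_rank 3 E = k \<and>
      (mix_face_le F E \<and> F \<noteq> E) \<and> mix_face_le E F' \<and> E \<noteq> F'}"
    have "\<exists>y \<in> G. {F, E, F'} \<subseteq> std_flag y"
      by (rule between) (use E F F' less in simp_all)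
    then obtain y where y: "y \<in> G" "F \<in> std_flag y" "F' \<in> std_flag y" "E \<in> std_flag y"
      by blast
    have Ey: "E = face j y"
      using std_flag_rank_inj[OF y(4), of "face j y"] face_in_std_flag_iff[OF j(1), of y y] E j(2) by simp
    have "face l y = face l x" if l: "l < 3" "l + 1 = j \<or> l = j + 1" for l
    proof -
      have "mix_face_rank 3 F = int l \<or> mix_face_rank 3 F' = int l" using l(2) rank j(2) by auto
      then obtain D where D: "D \<in> std_flag x" "D \<in> std_flag y" "mix_face_rank 3 D = int l"
        using x(2,3) y(2,3) by blast
      have "D = face l x" "D = face l y"
        using std_flag_rank_inj[OF D(1), of "face l x"] std_flag_rank_inj[OF D(2), of "face l y"]
          face_in_std_flag_iff[OF l(1)] D(3) by simp_all
      then show ?thesis by simp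
    qed
    then show "E \<in> {face j x, face j ?x}" using residue_faces[OF x(1) y(1) j(1)] Ey by auto
  next
    fix E assume "E \<in> {face j x, face j ?x}"
    then show "E \<in> {E \<in> carrier geometry. mix_face_rank 3 E = k \<and>
      (mix_face_le F E \<and> F \<noteq> E) \<and> mix_face_le E F' \<and> E \<noteq> F'}"
      using mem x x' \<open>F \<in> std_flag ?x\<close> \<open>F' \<in> std_flag ?x\<close> by blast
  qed
  then show ?thesis using std_flag_r(1)[OF x(1) j(1)] by simp
qed

lemma geometry_polytope: "polytope 3 geometry"
proof (intro polytope.intro polytope_axioms.intro geometry_partial_order)
  interpret partial_order geometry by (rule geometry_partial_order)
  have L: "least geometry Least_Face (carrier geometry)"
    unfolding least_def Lower_def carrier_geometry by (auto simp: carrier_geometry)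
  then show "\<exists>!F. least geometry F (carrier geometry) \<and> face_rank geometry F = -1"
    using least_unique by (intro ex1I[of _ Least_Face]) auto
  have Gr: "greatest geometry Greatest_Face (carrier geometry)"
    unfolding greatest_def Upper_def carrier_geometry by (auto simp: carrier_geometry)
  then show "\<exists>!F. greatest geometry F (carrier geometry) \<and> face_rank geometry F = int 3"
    using greatest_unique by (intro ex1I[of _ Greatest_Face]) auto
next
  fix F assume "F \<in> carrier geometry"
  then show "face_rank geometry F \<in> {-1..int 3}" unfolding carrier_geometry by auto
next
  fix F F' assume "F \<in> carrier geometry" "F' \<in> carrier geometry" "F \<sqsubset>\<^bsub>geometry\<^esub> F'"
  then show "face_rank geometry F < face_rank geometry F'"
    using geometry_rank_less lless_geometry by simp
next
  fix X assume "flag geometry X"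
  then obtain x where X: "X = std_flag x" unfolding flag_geometry_iff by blast
  have "card ((\<lambda>j. face j x) ` {..<3}) = 3"
    by (subst card_image) (auto intro: inj_onI dest: face_index)
  then show "card X = 3 + 2" unfolding X std_flag_def by (simp add: image_iff)
next
  show "strongly_flag_connected geometry"
    unfolding strongly_flag_connected_def
  proof (intro allI impI)
    fix X Y assume "flag geometry X" "flag geometry Y"
    then obtain x y where "x \<in> G" "y \<in> G" "X = std_flag x" "Y = std_flag y"
      unfolding flag_geometry_iff by blast
    then show "(\<lambda>X' Y'. flag geometry X' \<and> flag geometry Y' \<and> adjacent X' Y'
             \<and> X \<inter> Y \<subseteq> X' \<and> X \<inter> Y \<subseteq> Y')\<^sup>*\<^sup>* X Y"
      using std_flag_connected by simp
  qed
next
  fix F F' k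
  assume "F \<in> carrier geometry" "F' \<in> carrier geometry" "F \<sqsubset>\<^bsub>geometry\<^esub> F'"
    "face_rank geometry F = k - 1" "face_rank geometry F' = k + 1"
  then show "card {E \<in> carrier geometry. face_rank geometry E = k \<and> F \<sqsubset>\<^bsub>geometry\<^esub> E \<and> E \<sqsubset>\<^bsub>geometry\<^esub> F'} = 2"
    using geometry_diamond[of F F' k] unfolding lless_geometry by simp
qed

text \<open>
  Right multiplication by \<open>g\<close>, transported to faces. An odd \<open>g\<close> does not map even elements to even ones,
  so the image of a face cannot be formed elementwise; it is defined through a flag \<open>x\<close> that contains the
  face, and the choice of \<open>x\<close> is immaterial by \<open>face_translate_iff\<close>.
\<close>

definition translate :: "'a \<Rightarrow> 'a mix_face \<Rightarrow> 'a mix_face"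
  where "translate g F = (case F of
      Coset_Face j B \<Rightarrow> face j ((SOME x. x \<in> G \<and> F = face j x) \<otimes> g)
    | _ \<Rightarrow> F)"

lemma face_translate_iff:
  assumes "x \<in> G" "y \<in> G" "g \<in> G"
  shows "face i (x \<otimes> g) = face j (y \<otimes> g) \<longleftrightarrow> face i x = face j y"
proof -
  have c: "x \<in> carrier A" "y \<in> carrier A" "g \<in> carrier A" using assms G_carrier by auto
  have "x \<otimes> g \<otimes> inv (y \<otimes> g) = x \<otimes> (g \<otimes> inv g) \<otimes> inv y"
    using c by (simp only: inv_mult_group m_assoc m_closed inv_closed)
  then have "x \<otimes> g \<otimes> inv (y \<otimes> g) = x \<otimes> inv y" using c by simp
  then show ?thesis using assms G_mult face_eq_iff by simp
qed

lemma translate_face: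
  assumes x: "x \<in> G" and g: "g \<in> G"
  shows "translate g (face j x) = face j (x \<otimes> g)"
proof -
  let ?y = "SOME y. y \<in> G \<and> face j x = face j y"
  have y: "?y \<in> G \<and> face j x = face j ?y" by (rule someI[of _ x]) (use x in simp)
  have "translate g (face j x) = face j (?y \<otimes> g)"
    unfolding translate_def by (simp add: face_def)
  then show ?thesis using y face_translate_iff[OF x _ g, of ?y j j] by simp
qed

lemma translate_simps [simp]:
  "translate g Least_Face = Least_Face" "translate g Greatest_Face = Greatest_Face"
  by (simp_all add: translate_def)

lemma translate_closed:
  assumes "F \<in> carrier geometry" "g \<in> G" shows "translate g F \<in> carrier geometry"
proof -
  consider "F = Least_Face" | "F = Greatest_Face" | j x where "j < 3" "x \<in> G" "F = face j x"
    using assms(1) unfolding carrier_geometry by blast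
  then show ?thesis
  proof cases
    case 3
    then show ?thesis using translate_face assms(2) G_mult face_in_carrier by simp
  qed (auto simp: carrier_geometry)
qed

lemma translate_translate:
  assumes F: "F \<in> carrier geometry" and g: "g \<in> G" and h: "h \<in> G" and gh: "g \<otimes> h = \<one>"
  shows "translate h (translate g F) = F"
proof -
  have "x \<otimes> g \<otimes> h = x" if "x \<in> G" for x
    using gh G_carrier[OF that] G_carrier[OF g] G_carrier[OF h] by (simp add: m_assoc)
  note id = this
  consider "F = Least_Face" | "F = Greatest_Face" | j x where "j < 3" "x \<in> G" "F = face j x"
    using F unfolding carrier_geometry by blast
  then show ?thesis
  proof cases
    case 3
    then show ?thesis using id translate_face g h G_mult by simp
  qed simp_all
qed

lemma translate_le_iff:
  assumes F: "F \<in> carrier geometry" "F' \<in> carrier geometry" and g: "g \<in> G"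
  shows "mix_face_le (translate g F) (translate g F') \<longleftrightarrow> mix_face_le F F'"
proof -
  have mono: "mix_face_le (translate h E) (translate h E')"
    if h: "h \<in> G" and E: "E \<in> carrier geometry" "E' \<in> carrier geometry" "mix_face_le E E'" for E E' h
  proof -
    consider "E = Least_Face" | "E' = Greatest_Face" | "E = E'" | i j x y where
      "i < j" "x \<in> G" "y \<in> G" "E = face i x" "E' = face j y"
    proof -
      consider "E = Least_Face" | "E' = Greatest_Face" | "E = E'" | i j x y where
        "x \<in> G" "y \<in> G" "E = face i x" "E' = face j y"
        using E unfolding carrier_geometry by (metis le_Least_iff)
      then show thesis
      proof cases
        case 4
        then show thesis using that E(3) face_le_iff[OF 4(1,2)] by blast
      qed (use that in blast)+
    qed
    then show ?thesis
    proof cases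
      case 4
      then obtain z where z: "z \<in> G" "face i z = face i x" "face j z = face j y"
        using E(3) face_le_iff by (auto dest: face_index)
      then have "\<exists>z \<in> G. face i z = face i (x \<otimes> h) \<and> face j z = face j (y \<otimes> h)"
        using 4 h face_translate_iff G_mult by (intro bexI[of _ "z \<otimes> h"]) auto
      then show ?thesis using 4 h translate_face face_le_iff G_mult by simp
    qed (auto simp: mix_face_le_def)
  qed
  have gi: "inv g \<in> G" "g \<otimes> inv g = \<one>" using g G_inv G_carrier by auto
  show ?thesis
  proof
    assume "mix_face_le (translate g F) (translate g F')"
    from mono[OF gi(1) translate_closed[OF F(1) g] translate_closed[OF F(2) g] this]
    show "mix_face_le F F'" using translate_translate[OF _ g gi] F by simp
  qed (rule mono[OF g F])
qed

lemma translate_aut: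
  assumes g: "g \<in> G"
  shows "restrict (translate g) (carrier geometry) \<in> carrier (aut_group geometry)"
proof -
  interpret partial_order geometry by (rule geometry_partial_order)
  have gi: "inv g \<in> G" "g \<otimes> inv g = \<one>" "inv g \<otimes> g = \<one>" using g G_inv G_carrier by auto
  have "bij_betw (translate g) (carrier geometry) (carrier geometry)"
    by (rule bij_betw_byWitness[of _ "translate (inv g)"])
      (use translate_translate[OF _ g gi(1,2)] translate_translate[OF _ gi(1) g gi(3)]
        translate_closed g gi(1) in auto)
  then have "bij_betw (restrict (translate g) (carrier geometry)) (carrier geometry) (carrier geometry)"
    by (subst bij_betw_cong[of _ _ "translate g"]) auto
  moreover have "order_emb geometry geometry (restrict (translate g) (carrier geometry))"
    unfolding order_emb_def using translate_le_iff[OF _ _ g] weak_partial_order_axioms by simp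
  ultimately show ?thesis by (simp add: aut_group_iff Bij_def)
qed

lemma translate_std_flag:
  assumes x: "x \<in> G" and g: "g \<in> G"
  shows "restrict (translate g) (carrier geometry) ` std_flag x = std_flag (x \<otimes> g)"
proof -
  have "restrict (translate g) (carrier geometry) ` std_flag x = translate g ` std_flag x"
    using std_flag_carrier[OF x] by (intro image_cong refl) auto
  also have "\<dots> = std_flag (x \<otimes> g)"
    using translate_face[OF x g] unfolding std_flag_def by (simp add: image_Un image_image)
  finally show ?thesis .
qed

lemma geometry_regular: "regular geometry"
  unfolding regular_def
proof (intro allI impI)
  fix X Y assume "flag geometry X" "flag geometry Y"
  then obtain x y where xy: "x \<in> G" "y \<in> G" "X = std_flag x" "Y = std_flag y"
    unfolding flag_geometry_iff by blast
  have "x \<otimes> (inv x \<otimes> y) = y"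
    using G_carrier[OF xy(1)] G_carrier[OF xy(2)] by (simp add: m_assoc[symmetric])
  moreover have g: "inv x \<otimes> y \<in> G" using xy G_mult G_inv by blast
  ultimately have "restrict (translate (inv x \<otimes> y)) (carrier geometry) ` X = Y"
    using translate_std_flag[OF xy(1) g] xy by simp
  then show "\<exists>\<gamma> \<in> carrier (aut_group geometry). \<gamma> ` X = Y" using translate_aut[OF g] by blast
qed

text \<open>
  Left multiplication by \<open>r\<^sub>i\<close> is the passage to the \<open>i\<close>-adjacent flag and changes the parity, so parity
  is a proper 2-colouring of the flag graph.
\<close>

lemma geometry_directly_regular: "directly_regular_polytope 3 geometry"
  unfolding directly_regular_polytope_def
proof (intro conjI allI impI geometry_polytope geometry_regular)
  fix X assume X: "flag geometry X"
  interpret regular_polytope 3 geometry X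
    by (intro regular_polytope.intro regular_polytope_axioms.intro geometry_polytope geometry_regular X)
  have adj: "adjacent_flag geometry i (std_flag x) = std_flag (r i \<otimes> x)" if x: "x \<in> G" and i: "i < 3" for x i
  proof (rule adjacent_flag_eq[OF _ i])
    show "flag geometry (std_flag x)" "flag geometry (std_flag (r i \<otimes> x))"
      using x i r_G G_mult unfolding flag_geometry_iff by blast+
    show "differ_exactly_at geometry i (std_flag x) (std_flag (r i \<otimes> x))"
      unfolding differ_exactly_at_def geometry_simps
    proof (intro conjI Set.set_eqI)
      show "std_flag x \<noteq> std_flag (r i \<otimes> x)" using std_flag_r(2)[OF x i] by blast
      fix F
      show "F \<in> {F \<in> std_flag x. mix_face_rank 3 F \<noteq> int i} \<longleftrightarrow>
        F \<in> {F \<in> std_flag (r i \<otimes> x). mix_face_rank 3 F \<noteq> int i}"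
      proof (cases "mix_face_rank 3 F = int i")
        case False
        then have "F \<noteq> face i x" "F \<noteq> face i (r i \<otimes> x)" by auto
        then have "F \<in> std_flag x \<longleftrightarrow> F \<in> std_flag (r i \<otimes> x)" using std_flag_r(2,3)[OF x i] by blast
        then show ?thesis by simp
      qed simp
    qed
  qed
  \<comment> \<open>The colour of a flag is the parity of the group element that indexes it.\<close>
  define col where "col Y \<longleftrightarrow> (\<exists>x \<in> G. Y = std_flag x \<and> ev x)" for Y
  have col: "col (std_flag x) \<longleftrightarrow> ev x" if "x \<in> G" for x
    using std_flag_inj[OF that] that unfolding col_def by metis
  have "rho 0 \<notin> rotations"
  proof (rule bipartite_imp_rho_not_rotation[where col = col])
    fix Y and i :: nat assume "flag geometry Y" and i: "i < 3"
    then obtain x where x: "x \<in> G" "Y = std_flag x" unfolding flag_geometry_iff by blast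
    then show "col (adjacent_flag geometry i Y) \<longleftrightarrow> \<not> col Y"
      using adj[OF x(1) i] col ev_r[OF i x(1)] G_mult[OF r_G[OF i] x(1)] by simp
  qed simp
  then show "card (rcosets\<^bsub>aut_group geometry\<^esub> rotations) = 2" using rotation_index_2_iff by simp
qed

end

section \<open>The mix of two directly regular polyhedra\<close>

lemma directly_regular_rho_0:
  assumes "directly_regular_polytope n P" "flag P \<Phi>" "0 < n"
  shows "regular_polytope n P \<Phi>" "\<rho> P \<Phi> 0 \<notin> carrier (rotation_group n P \<Phi>)"
proof -
  show rp: "regular_polytope n P \<Phi>"
    using assms unfolding directly_regular_polytope_def
    by (intro regular_polytope.intro regular_polytope_axioms.intro) auto
  show "\<rho> P \<Phi> 0 \<notin> carrier (rotation_group n P \<Phi>)"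
    using assms regular_polytope.rotation_index_2_iff[OF rp assms(3)]
    unfolding directly_regular_polytope_def by blast
qed

text \<open>
  Direct regularity is stated through \<open>\<rho>\<^sub>0\<close> not being a rotation, the form that provides a parity.
\<close>

locale two_directly_regular_polyhedra =
  P: regular_polytope 3 P \<Phi> + Q: regular_polytope 3 Q \<Psi>
  for P :: "('a, 'm) ranked_poset_scheme" and \<Phi> and Q :: "('b, 'k) ranked_poset_scheme" and \<Psi> +
  assumes P_direct: "P.rho 0 \<notin> P.rotations" and Q_direct: "Q.rho 0 \<notin> Q.rotations"
begin

abbreviation "A \<equiv> aut_group P \<times>\<times> aut_group Q"

definition "r i = (P.rho i, Q.rho i)"

text \<open>
  The first component decides the parity of the pair; on the elements of interest the second one agrees
  with it, by the last part of \<open>components\<close>.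
\<close>

definition "ev g \<longleftrightarrow> fst g \<in> P.rotations"

sublocale A: group A
  by (rule DirProd_group[OF P.group_aut_group Q.group_aut_group])

lemma r_closed: "i < 3 \<Longrightarrow> r i \<in> carrier A"
  using P.rho(1) Q.rho(1) by (simp add: r_def)

lemma r_subset: "I \<subseteq> {..<3} \<Longrightarrow> r ` I \<subseteq> carrier A"
  using r_closed by blast

lemma r_involution: "i < 3 \<Longrightarrow> r i \<otimes>\<^bsub>A\<^esub> r i = \<one>\<^bsub>A\<^esub>"
  using P.rho_involution Q.rho_involution by (simp add: r_def)

text \<open>
  The last conclusion holds because the same word represents both components, and in either group its
  parity decides whether the result is a rotation.
\<close>

lemma components:
  assumes I: "I \<subseteq> {..<3}" and g: "g \<in> generate A (r ` I)"
  shows "fst g \<in> generate (aut_group P) (P.rho ` I)"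
    and "snd g \<in> generate (aut_group Q) (Q.rho ` I)"
    and "fst g \<in> P.rotations \<longleftrightarrow> snd g \<in> Q.rotations"
proof -
  let ?Q = "\<lambda>g. fst g \<in> generate (aut_group P) (P.rho ` I) \<and> snd g \<in> generate (aut_group Q) (Q.rho ` I)
    \<and> (fst g \<in> P.rotations \<longleftrightarrow> snd g \<in> Q.rotations)"
  have sub: "r ` I \<subseteq> carrier A" "P.rho ` I \<subseteq> P.Aut" "Q.rho ` I \<subseteq> Q.Aut"
    using I r_subset P.rho(1) Q.rho(1) by auto
  have "?Q g"
    using g sub(1)
  proof (rule A.generate_involutions_induct)
    fix s assume "s \<in> r ` I"
    then show "s \<otimes>\<^bsub>A\<^esub> s = \<one>\<^bsub>A\<^esub>" using r_involution I by auto
  next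
    show "?Q \<one>\<^bsub>A\<^esub>"
      using subgroup.one_closed[OF P.rotations_subgroup] subgroup.one_closed[OF Q.rotations_subgroup]
      by (simp add: generate.one)
  next
    fix x s assume x: "?Q x" and "s \<in> r ` I"
    then obtain i where i: "i \<in> I" "s = r i" "i < 3" using I by auto
    have c: "fst x \<in> P.Aut" "snd x \<in> Q.Aut"
      using x P.aut.generate_in_carrier[OF sub(2)] Q.aut.generate_in_carrier[OF sub(3)] by auto
    have "fst x \<otimes>\<^bsub>aut_group P\<^esub> P.rho i \<in> generate (aut_group P) (P.rho ` I)"
      using x i by (intro generate.eng) (auto intro: generate.incl)
    moreover have "snd x \<otimes>\<^bsub>aut_group Q\<^esub> Q.rho i \<in> generate (aut_group Q) (Q.rho ` I)"
      using x i by (intro generate.eng) (auto intro: generate.incl)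
    moreover have "fst x \<otimes>\<^bsub>aut_group P\<^esub> P.rho i \<in> P.rotations \<longleftrightarrow> snd x \<otimes>\<^bsub>aut_group Q\<^esub> Q.rho i \<in> Q.rotations"
      using x P.rotation_parity[OF _ P_direct c(1) P.rho(1)[OF i(3)]] P.rho_not_rotation[OF P_direct i(3)]
        Q.rotation_parity[OF _ Q_direct c(2) Q.rho(1)[OF i(3)]] Q.rho_not_rotation[OF Q_direct i(3)] by simp
    ultimately show "?Q (x \<otimes>\<^bsub>A\<^esub> s)" using i(2) by (simp add: r_def mult_DirProd')
  qed
  then show "fst g \<in> generate (aut_group P) (P.rho ` I)"
    and "snd g \<in> generate (aut_group Q) (Q.rho ` I)"
    and "fst g \<in> P.rotations \<longleftrightarrow> snd g \<in> Q.rotations" by auto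
qed

lemma components_Aut:
  assumes I: "I \<subseteq> {..<3}" and g: "g \<in> generate A (r ` I)"
  shows "fst g \<in> P.Aut" "snd g \<in> Q.Aut"
proof -
  have "P.rho ` I \<subseteq> P.Aut" "Q.rho ` I \<subseteq> Q.Aut" using I P.rho(1) Q.rho(1) by auto
  then show "fst g \<in> P.Aut" "snd g \<in> Q.Aut"
    using components[OF I g] P.aut.generate_in_carrier Q.aut.generate_in_carrier by blast+
qed

text \<open>
  Each component of \<open>g\<close> fixes every face of its base flag whose rank is outside \<open>I\<close> or outside \<open>J\<close>,
  hence all faces except possibly the \<open>k\<close>-face. This leaves the identity and \<open>\<rho>\<^sub>k\<close> for each component,
  and both components have the same parity.
\<close>

lemma intersection_property_small_overlap:
  assumes I: "I \<subseteq> {..<3}" and J: "J \<subseteq> {..<3}" and g: "g \<in> generate A (r ` I)" "g \<in> generate A (r ` J)"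
    and k: "k < 3" "I \<inter> J \<subseteq> {k}"
  shows "g \<in> generate A (r ` (I \<inter> J))"
proof -
  note cI = components[OF I g(1)] and cJ = components[OF J g(2)] and c = components_Aut[OF I g(1)]
  have fixP: "fst g F = F" if "F \<in> \<Phi>" "P.rank F \<notin> int ` (I \<inter> J)" for F
    using P.stabilizer[OF I cI(1) that(1)] P.stabilizer[OF J cJ(1) that(1)] that(2) by fastforce
  have fixQ: "snd g F = F" if "F \<in> \<Psi>" "Q.rank F \<notin> int ` (I \<inter> J)" for F
    using Q.stabilizer[OF I cI(2) that(1)] Q.stabilizer[OF J cJ(2) that(1)] that(2) by fastforce
  have one: "g = \<one>\<^bsub>A\<^esub>" if "fst g = \<one>\<^bsub>aut_group P\<^esub>" "snd g = \<one>\<^bsub>aut_group Q\<^esub>"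
    using that by (simp add: prod_eq_iff)
  show ?thesis
  proof (cases "k \<in> I \<inter> J")
    case False
    then have "I \<inter> J = {}" using k(2) by blast
    then have "fst g ` \<Phi> = \<Phi>" "snd g ` \<Psi> = \<Psi>" using fixP fixQ by (simp_all add: image_def)
    then have "g = \<one>\<^bsub>A\<^esub>"
      using one P.aut_fixing_flag_is_one[OF c(1) P.base_flag] Q.aut_fixing_flag_is_one[OF c(2) Q.base_flag] by blast
    then show ?thesis using generate.one[of A] by metis
  next
    case True
    then have k1: "I \<inter> J = {k}" using k(2) by blast
    have "fst g = \<one>\<^bsub>aut_group P\<^esub> \<or> fst g = P.rho k"
      using P.fixing_all_but_one_face[OF c(1) k(1)] fixP k1 by simp
    moreover have "snd g = \<one>\<^bsub>aut_group Q\<^esub> \<or> snd g = Q.rho k"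
      using Q.fixing_all_but_one_face[OF c(2) k(1)] fixQ k1 by simp
    ultimately have "g = \<one>\<^bsub>A\<^esub> \<or> g = r k"
      using cI(3) P.rho_not_rotation[OF P_direct k(1)] Q.rho_not_rotation[OF Q_direct k(1)]
        subgroup.one_closed[OF P.rotations_subgroup] subgroup.one_closed[OF Q.rotations_subgroup]
      by (auto simp: r_def prod_eq_iff)
    moreover have "r k \<in> generate A (r ` (I \<inter> J))" using True by (intro generate.incl imageI)
    ultimately show ?thesis using generate.one[of A] by metis
  qed
qed

text \<open>
  Neither an element of \<open>I - J\<close> nor one of \<open>J - I\<close> lies in the intersection, which leaves one of the
  three indices. This is where rank 3 enters: in higher rank incomparable index sets can meet in more
  than one element.
\<close>

lemma subsets_of_three:
  assumes "I \<subseteq> {..<3 :: nat}" "J \<subseteq> {..<3}" "\<not> I \<subseteq> J" "\<not> J \<subseteq> I"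
  obtains k where "k < 3" "I \<inter> J \<subseteq> {k}"
proof -
  obtain a b where ab: "a \<in> I" "a \<notin> J" "b \<in> J" "b \<notin> I" using assms(3,4) by blast
  have "card ({..<3} - {a, b}) = card {..<3 :: nat} - card {a, b}"
    using ab assms(1,2) by (intro card_Diff_subset) auto
  moreover have "a \<noteq> b" using ab by blast
  ultimately have "card ({..<3} - {a, b}) = 1" by simp
  then obtain k where k: "{..<3} - {a, b} = {k}" by (rule card_1_singletonE)
  show thesis
  proof (rule that)
    show "k < 3" using k by blast
    show "I \<inter> J \<subseteq> {k}" using k ab assms(1,2) by blast
  qed
qed

sublocale oriented_string_C_group_3 A r ev
proof
  show "i < 3 \<Longrightarrow> r i \<in> carrier A" for i by (rule r_closed)
  show "i < 3 \<Longrightarrow> r i \<otimes>\<^bsub>A\<^esub> r i = \<one>\<^bsub>A\<^esub>" for i by (rule r_involution)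
  show "r 0 \<otimes>\<^bsub>A\<^esub> r 2 = r 2 \<otimes>\<^bsub>A\<^esub> r 0"
    using P.rho_commute[of 0 2] Q.rho_commute[of 0 2] by (simp add: r_def)
  show "ev (x \<otimes>\<^bsub>A\<^esub> y) \<longleftrightarrow> (ev x \<longleftrightarrow> ev y)"
    if "x \<in> generate A (r ` {..<3})" "y \<in> generate A (r ` {..<3})" for x y
    using P.rotation_parity[OF _ P_direct components_Aut(1)[OF _ that(1)] components_Aut(1)[OF _ that(2)]]
    by (simp add: ev_def mult_DirProd')
  show "\<not> ev (r i)" if "i < 3" for i
    using P.rho_not_rotation[OF P_direct that] by (simp add: ev_def r_def)
  \<comment> \<open>For nested index sets the smaller subgroup is the intersection.\<close>
  show "generate A (r ` I) \<inter> generate A (r ` J) \<subseteq> generate A (r ` (I \<inter> J))"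
    if IJ: "I \<subseteq> {..<3}" "J \<subseteq> {..<3}" for I J
  proof (cases "I \<subseteq> J \<or> J \<subseteq> I")
    case True
    then show ?thesis by (metis Int_absorb1 Int_absorb2 Int_lower1 Int_lower2)
  next
    case False
    then obtain k where "k < 3" "I \<inter> J \<subseteq> {k}" using subsets_of_three IJ by blast
    then show ?thesis using intersection_property_small_overlap IJ by blast
  qed
qed

lemma beta_eq:
  "\<beta> P \<Phi> Q \<Psi> i = r (i - 1) \<otimes>\<^bsub>A\<^esub> r i"
  by (simp add: \<beta>_def \<sigma>_def r_def)

declare carrier_DirProd [simp del] one_DirProd [simp del] mult_DirProd [simp del]

lemma even_part:
  assumes I: "I \<subseteq> {..<3}" and s0: "i\<^sub>0 \<in> I" and T: "T \<subseteq> H I" "\<And>t. t \<in> T \<Longrightarrow> ev t"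
    and prod: "\<And>i. i \<in> I \<Longrightarrow> r i \<otimes>\<^bsub>A\<^esub> r i\<^sub>0 \<in> generate A T"
  shows "{x \<in> H I. ev x} = generate A T"
  unfolding H_def
proof (rule A.even_elements_eq_generate[of _ "r i\<^sub>0"])
  show "r ` I \<subseteq> carrier A" by (rule r_subset[OF I])
  show "T \<subseteq> generate A (r ` I)" using T(1) by (simp add: H_def)
  show "\<not> ev (r i\<^sub>0)" using r_odd I s0 by auto
  show "ev (x \<otimes>\<^bsub>A\<^esub> y) \<longleftrightarrow> (ev x \<longleftrightarrow> ev y)" if "x \<in> generate A (r ` I)" "y \<in> generate A (r ` I)" for x y
    using ev_mult H_mono[OF I] that unfolding H_def by blast
qed (use I s0 T(2) prod r_involution in auto)

lemma beta:
  assumes "i \<in> {1, 2}"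
  shows "\<beta> P \<Phi> Q \<Psi> i \<in> H {i - 1, i}" "ev (\<beta> P \<Phi> Q \<Psi> i)"
proof -
  have i: "i - 1 < 3" "i < 3" using assms by auto
  show "\<beta> P \<Phi> Q \<Psi> i \<in> H {i - 1, i}"
    unfolding beta_eq by (rule subgroup.m_closed[OF H_subgroup]) (use i r_in_H in auto)
  show "ev (\<beta> P \<Phi> Q \<Psi> i)"
    unfolding beta_eq using ev_r[OF i(1) r_G[OF i(2)]] r_odd[OF i(2)] by simp
qed

lemma inv_r_r: "i < 3 \<Longrightarrow> j < 3 \<Longrightarrow> inv\<^bsub>A\<^esub> (r i \<otimes>\<^bsub>A\<^esub> r j) = r j \<otimes>\<^bsub>A\<^esub> r i"
  using r_closed[of i] r_closed[of j] r_involution[of i] r_involution[of j]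
  by (simp add: A.inv_mult_group A.inv_equality)

lemma generate_r_r:
  assumes "i < 3" "j < 3" "r i \<otimes>\<^bsub>A\<^esub> r j \<in> generate A T" "T \<subseteq> carrier A"
  shows "r j \<otimes>\<^bsub>A\<^esub> r i \<in> generate A T"
  using A.generate_m_inv_closed[OF assms(4,3)] inv_r_r[OF assms(1,2)] by simp

lemma beta_1_2: "\<beta> P \<Phi> Q \<Psi> 1 \<otimes>\<^bsub>A\<^esub> \<beta> P \<Phi> Q \<Psi> 2 = r 0 \<otimes>\<^bsub>A\<^esub> r 2"
proof -
  have c: "r 0 \<in> carrier A" "r 1 \<in> carrier A" "r 2 \<in> carrier A" by (simp_all only: r_closed)
  have "(r 0 \<otimes>\<^bsub>A\<^esub> r 1) \<otimes>\<^bsub>A\<^esub> (r 1 \<otimes>\<^bsub>A\<^esub> r 2) = r 0 \<otimes>\<^bsub>A\<^esub> (r 1 \<otimes>\<^bsub>A\<^esub> r 1) \<otimes>\<^bsub>A\<^esub> r 2"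
    using c by (simp only: A.m_assoc A.m_closed)
  then show ?thesis using c r_involution[of 1] by (simp add: beta_eq)
qed

text \<open>
  The group of the mix is generated by \<open>r\<^sub>0 r\<^sub>1\<close> and \<open>r\<^sub>1 r\<^sub>2\<close>; together with its coset by \<open>r\<^sub>1\<close> it
  exhausts \<open>G\<close>, so it consists of all even elements.
\<close>

lemma mix_group_eq:
  "carrier (mix_group 3 P \<Phi> Q \<Psi>) = {x \<in> G. ev x}"
  "mult (mix_group 3 P \<Phi> Q \<Psi>) = mult A"
  "one (mix_group 3 P \<Phi> Q \<Psi>) = one A"
  "S \<subseteq> {x \<in> G. ev x} \<Longrightarrow> generate (mix_group 3 P \<Phi> Q \<Psi>) S = generate A S"
proof -
  show "mult (mix_group 3 P \<Phi> Q \<Psi>) = mult A" "one (mix_group 3 P \<Phi> Q \<Psi>) = one A"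
    by (simp_all add: mix_group_def rotation_group_def DirProd_def)
  let ?T = "\<beta> P \<Phi> Q \<Psi> ` {1, 2}" and ?R = "rotation_group 3 P \<Phi> \<times>\<times> rotation_group 3 Q \<Psi>"
  have R: "?R = A\<lparr>carrier := P.rotations \<times> Q.rotations\<rparr>"
    by (simp add: rotation_group_def subgroup_generated_def DirProd_def)
  have RA: "subgroup (P.rotations \<times> Q.rotations) A"
    by (rule DirProd_subgroups[OF P.group_aut_group P.rotations_subgroup Q.group_aut_group Q.rotations_subgroup])
  have "\<sigma> P \<Phi> i \<in> P.rotations" "\<sigma> Q \<Psi> i \<in> Q.rotations" if "i \<in> {1, 2}" for i
    unfolding P.rotations_eq Q.rotations_eq using that by (auto intro!: generate.incl)
  then have TR: "?T \<subseteq> P.rotations \<times> Q.rotations" by (auto simp: \<beta>_def)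
  have TG: "?T \<subseteq> {x \<in> G. ev x}"
  proof
    fix t assume "t \<in> ?T"
    then obtain i where i: "i \<in> {1, 2}" "t = \<beta> P \<Phi> Q \<Psi> i" by blast
    moreover have "{i - 1, i} \<subseteq> {..<3}" using i(1) by auto
    ultimately show "t \<in> {x \<in> G. ev x}" using beta[OF i(1)] H_mono by blast
  qed
  have Tc: "?T \<subseteq> carrier A" using TG G_carrier by blast
  have "{1..3 - 1} = {1, 2 :: nat}" by auto
  then have mg: "mix_group 3 P \<Phi> Q \<Psi> = A\<lparr>carrier := generate A ?T\<rparr>"
    unfolding mix_group_def subgroup_generated_def R
    using A.generate_consistent[OF TR RA] TR by (simp add: inf.absorb2)
  have "{x \<in> G. ev x} = generate A ?T"
  proof (rule even_part[of _ 1])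
    have "\<beta> P \<Phi> Q \<Psi> 1 \<in> generate A ?T" "\<beta> P \<Phi> Q \<Psi> 2 \<in> generate A ?T" by (auto intro: generate.incl)
    then have "r 0 \<otimes>\<^bsub>A\<^esub> r 1 \<in> generate A ?T" "r 1 \<otimes>\<^bsub>A\<^esub> r 2 \<in> generate A ?T" by (simp_all add: beta_eq)
    moreover from this(2) have "r 2 \<otimes>\<^bsub>A\<^esub> r 1 \<in> generate A ?T" by (intro generate_r_r[of 1 2] Tc) simp_all
    moreover have "r 1 \<otimes>\<^bsub>A\<^esub> r 1 \<in> generate A ?T" using r_involution[of 1] generate.one[of A ?T] by simp
    ultimately show "r i \<otimes>\<^bsub>A\<^esub> r 1 \<in> generate A ?T" if "i \<in> {..<3}" for i
      using that by (elim less_3_cases[OF lessThan_iff[THEN iffD1]]) simp_all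
  qed (use TG in auto)
  then show car: "carrier (mix_group 3 P \<Phi> Q \<Psi>) = {x \<in> G. ev x}" unfolding mg by simp
  show "generate (mix_group 3 P \<Phi> Q \<Psi>) S = generate A S" if "S \<subseteq> {x \<in> G. ev x}"
    unfolding mg using that car A.generate_consistent[OF _ A.generate_is_subgroup[OF Tc]] mg by simp
qed

text \<open>
  Exactly one product \<open>\<beta>\<^sub>i \<dots> \<beta>\<^sub>l\<close> is admitted for each \<open>j\<close>, namely \<open>r\<^sub>a r\<^sub>b\<close> where \<open>a < b\<close> are the two
  indices different from \<open>j\<close>; it generates the even elements of the dihedral group generated by \<open>r\<^sub>a\<close> and \<open>r\<^sub>b\<close>.
\<close>

lemma mix_subgroup_eq:
  assumes j: "j < 3"
  shows "mix_subgroup 3 P \<Phi> Q \<Psi> ({0..<3} - {j}) = {x \<in> stab j. ev x}"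
proof -
  let ?b = "\<beta> P \<Phi> Q \<Psi>"
  define T where "T = {foldr (\<lambda>k g. ?b k \<otimes>\<^bsub>A\<^esub> g) [i..<Suc l] \<one>\<^bsub>A\<^esub> | i l.
       1 \<le> i \<and> i \<le> l \<and> l \<le> 3 - 1 \<and> i - 1 \<in> {0..<3} - {j} \<and> l \<in> {0..<3} - {j}}"
  have bc: "?b 1 \<in> carrier A" "?b 2 \<in> carrier A"
    unfolding beta_eq using r_closed by simp_all
  define w where "w i l = foldr (\<lambda>k g. ?b k \<otimes>\<^bsub>A\<^esub> g) [i..<Suc l] \<one>\<^bsub>A\<^esub>" for i l
  have fold: "w 1 1 = r 0 \<otimes>\<^bsub>A\<^esub> r 1"
    "w 2 2 = r 1 \<otimes>\<^bsub>A\<^esub> r 2"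
    "w 1 2 = r 0 \<otimes>\<^bsub>A\<^esub> r 2"
  proof -
    have u: "[1..<Suc 1] = [1]" "[2..<Suc 2] = [2]" "[1..<Suc 2] = [1, 2]" by (simp_all add: upt_rec)
    show "w 1 1 = r 0 \<otimes>\<^bsub>A\<^esub> r 1"
      unfolding w_def u using bc(1) by (simp add: beta_eq)
    show "w 2 2 = r 1 \<otimes>\<^bsub>A\<^esub> r 2"
      unfolding w_def u using bc(2) by (simp add: beta_eq)
    show "w 1 2 = r 0 \<otimes>\<^bsub>A\<^esub> r 2"
      unfolding w_def u using bc(2) beta_1_2 by (simp)
  qed
  obtain a b where ab: "a < b" "b < 3" "{..<3} - {j} = {a, b}" "T = {r a \<otimes>\<^bsub>A\<^esub> r b}"
  proof -
    define c where "c i l \<longleftrightarrow> 1 \<le> i \<and> i \<le> l \<and> l \<le> 3 - 1 \<and> i - 1 \<in> {0..<3} - {j} \<and> l \<in> {0..<3} - {j}" for i l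
    have T: "T = {w i l | i l. c i l}"
      unfolding T_def c_def w_def ..
    from j show thesis
    proof (rule less_3_cases)
      assume j: "j = 0"
      then have "c i l \<longleftrightarrow> i = 2 \<and> l = 2" for i l unfolding c_def by auto
      then have "T = {r 1 \<otimes>\<^bsub>A\<^esub> r 2}" unfolding T using fold by simp
      moreover have "{..<3} - {j} = {1, 2}" using j by auto
      ultimately show thesis using that[of 1 2] by simp
    next
      assume j: "j = 1"
      then have "c i l \<longleftrightarrow> i = 1 \<and> l = 2" for i l unfolding c_def by auto
      then have "T = {r 0 \<otimes>\<^bsub>A\<^esub> r 2}" unfolding T using fold by simp
      moreover have "{..<3} - {j} = {0, 2}" using j by auto
      ultimately show thesis using that[of 0 2] by simp
    next
      assume j: "j = 2"
      then have "c i l \<longleftrightarrow> i = 1 \<and> l = 1" for i l unfolding c_def by auto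
      then have "T = {r 0 \<otimes>\<^bsub>A\<^esub> r 1}" unfolding T using fold by simp
      moreover have "{..<3} - {j} = {0, 1}" using j by auto
      ultimately show thesis using that[of 0 1] by simp
    qed
  qed
  have a3: "a < 3" using ab by simp
  have TH: "T \<subseteq> H {a, b}" 
    unfolding ab(4) using subgroup.m_closed[OF H_subgroup] r_in_H ab a3 by auto
  have evT: "ev t" if "t \<in> T" for t
    using that ev_r[OF a3 r_G[OF ab(2)]] r_odd[OF ab(2)] unfolding ab(4) by simp
  have Tc: "T \<subseteq> carrier A" unfolding ab(4) using r_closed a3 ab(2) by simp
  have "{x \<in> H {a, b}. ev x} = generate A T"
  proof (rule even_part[of _ b])
    have "r a \<otimes>\<^bsub>A\<^esub> r b \<in> generate A T" unfolding ab(4) by (simp add: generate.incl)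
    moreover have "r b \<otimes>\<^bsub>A\<^esub> r b \<in> generate A T" using r_involution[OF ab(2)] generate.one[of A T] by simp
    ultimately show "r i \<otimes>\<^bsub>A\<^esub> r b \<in> generate A T" if "i \<in> {a, b}" for i using that by auto
  qed (use TH evT ab a3 in auto)
  moreover have "T \<subseteq> {x \<in> G. ev x}" using TH evT H_mono[of "{a, b}" "{..<3}"] ab a3 by auto
  ultimately show ?thesis
    unfolding mix_subgroup_def Let_def mix_group_eq(2,3) T_def[symmetric]
    using mix_group_eq(4)[of T] ab(3) unfolding stab_def by simp
qed

text \<open>
  The faces of the mix are the cosets of even elements, whereas the faces of the geometry are indexed by
  all of \<open>G\<close>; every face has an even representative, so both families coincide.
\<close>

lemma mix_eq_geometry: "mix 3 P \<Phi> Q \<Psi> = geometry"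
proof -
  have "{Coset_Face j B | j B. j < 3 \<and>
          B \<in> rcosets\<^bsub>mix_group 3 P \<Phi> Q \<Psi>\<^esub> (mix_subgroup 3 P \<Phi> Q \<Psi> ({0..<3} - {j}))}
     = {face j x | j x. j < 3 \<and> x \<in> G}" (is "?L = ?R")
  proof -
    have coset: "{x \<in> stab j. ev x} #>\<^bsub>mix_group 3 P \<Phi> Q \<Psi>\<^esub> z = {y \<in> G. ev y \<and> y \<otimes>\<^bsub>A\<^esub> inv\<^bsub>A\<^esub> z \<in> stab j}"
      if z: "z \<in> G" "ev z" for z j
    proof -
      note zc = G_carrier[OF z(1)]
      have "\<exists>h. h \<in> stab j \<and> ev h \<and> y = h \<otimes>\<^bsub>A\<^esub> z" if y: "y \<in> G" "ev y" "y \<otimes>\<^bsub>A\<^esub> inv\<^bsub>A\<^esub> z \<in> stab j" for y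
      proof -
        have eq: "y = y \<otimes>\<^bsub>A\<^esub> inv\<^bsub>A\<^esub> z \<otimes>\<^bsub>A\<^esub> z" using zc G_carrier[OF y(1)] by (simp add: A.m_assoc)
        have "ev (y \<otimes>\<^bsub>A\<^esub> inv\<^bsub>A\<^esub> z)"
          using ev_mult[of "y \<otimes>\<^bsub>A\<^esub> inv\<^bsub>A\<^esub> z" z] eq y z G_mult[OF y(1) G_inv[OF z(1)]] unfolding H_def by simp
        then show ?thesis using eq y(3) by blast
      qed
      moreover have "h \<otimes>\<^bsub>A\<^esub> z \<in> G \<and> ev (h \<otimes>\<^bsub>A\<^esub> z) \<and> h \<otimes>\<^bsub>A\<^esub> z \<otimes>\<^bsub>A\<^esub> inv\<^bsub>A\<^esub> z \<in> stab j" if h: "h \<in> stab j" "ev h" for h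
      proof -
        have hG: "h \<in> G" using h(1) stab_subset by blast
        have "h \<otimes>\<^bsub>A\<^esub> z \<otimes>\<^bsub>A\<^esub> inv\<^bsub>A\<^esub> z = h" using zc G_carrier[OF hG] by (simp add: A.m_assoc)
        then show ?thesis using hG h z ev_mult G_mult[OF hG z(1)] unfolding H_def by simp
      qed
      ultimately show ?thesis unfolding r_coset_def mix_group_eq(2) by blast
    qed
    have cosets: "rcosets\<^bsub>mix_group 3 P \<Phi> Q \<Psi>\<^esub> (mix_subgroup 3 P \<Phi> Q \<Psi> ({0..<3} - {j}))
      = (\<lambda>z. {y \<in> G. ev y \<and> y \<otimes>\<^bsub>A\<^esub> inv\<^bsub>A\<^esub> z \<in> stab j}) ` {z \<in> G. ev z}" if "j < 3" for j
      unfolding mix_subgroup_eq[OF that] RCOSETS_def mix_group_eq(1) using coset by auto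
    have L: "?L = {face j z | j z. j < 3 \<and> z \<in> G \<and> ev z}"
      using cosets unfolding face_def by (auto simp: image_iff) blast+
    also have "\<dots> = ?R"
      using even_representative by (auto; metis)
    finally show ?thesis .
  qed
  then show ?thesis unfolding mix_def geometry_def by simp
qed

end

theorem corollary3p11:
  fixes P :: "'a ranked_poset" and Q :: "'b ranked_poset"
    and \<Phi> :: "'a set" and \<Psi> :: "'b set"
  assumes "directly_regular_polytope 3 P" and "directly_regular_polytope 3 Q"
    and "flag P \<Phi>" and "flag Q \<Psi>"
  shows "directly_regular_polytope 3 (mix 3 P \<Phi> Q \<Psi>)"
proof -
  interpret two_directly_regular_polyhedra P \<Phi> Q \<Psi>
    using directly_regular_rho_0[OF assms(1,3)] directly_regular_rho_0[OF assms(2,4)]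
    by (intro two_directly_regular_polyhedra.intro two_directly_regular_polyhedra_axioms.intro) auto
  show ?thesis using geometry_directly_regular mix_eq_geometry by simp
qed

end
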